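(* Suppose $(G_i, \pi^j_i)$ is a surjective inverse system of topological groups, and let $G = \varprojlim_i G_i$. If every $G_i$ is CAP, then $G$ is CAP.
   Context: All topological groups and spaces are Hausdorff. For a topological group $G$, a $G$-flow is a (non-empty) compact Hausdorff space with a continuous left action of $G$; a subflow is a non-empty closed $G$-invariant subset; a flow is minimal if it has no proper subflow. For a $G$-flow $X$, $\mathrm{AP}_G(X)=\{x\in X:\overline{Gx}\text{ is minimal}\}$. $G$ is CAP if $\mathrm{AP}_G(X)$ is closed in $X$ for every $G$-flow $X$. An inverse system of topological groups $(G_i,\pi^j_i)$ consists of a directed set $I$, a topological group $G_i$ for each $i\in I$, and a continuous group homomorphism $\pi^j_i\colon G_j\to G_i$ for each $i\le j$ in $I$ (with the usual compatibility $\pi^i_i=\mathrm{id}$ and $\pi^j_i\circ\pi^k_j=\pi^k_i$ for $i\le j\le k$). Its inverse limit is the topological group $\varprojlim_i G_i=\{(g_i)_i\in\prod_i G_i: \pi^j_i(g_j)=g_i \text{ for all } i\le j\in I\}$ with the topology inherited from the product. The system is surjective if each coordinate projection $\pi_i\colon\varprojlim_i G_i\to G_i$ is surjective. *)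

theory Defs
  imports "HOL-Analysis.Analysis" "HOL-Algebra.Group_Action" "HOL-Algebra.Product_Groups"
begin

no_notation eq_closure_of ("closure'_of\<index>")

locale topological_group = group G for G (structure) +
  fixes T :: "'g topology"
  assumes topspace_eq_carrier: "topspace T = carrier G"
    and Hausdorff: "Hausdorff_space T"
    and continuous_mult: "continuous_map (prod_topology T T) T (\<lambda>(x, y). x \<otimes> y)"
    and continuous_inv: "continuous_map T T (\<lambda>x. inv x)"

definition flow ::
  "('g, 'm) monoid_scheme \<Rightarrow> 'g topology \<Rightarrow> 'x topology \<Rightarrow> ('g \<Rightarrow> 'x \<Rightarrow> 'x) \<Rightarrow> bool" where
  "flow G T X \<phi> \<longleftrightarrow>
     topspace X \<noteq> {} \<and> compact_space X \<and> Hausdorff_space X \<and>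
     group_action G (topspace X) \<phi> \<and>
     continuous_map (prod_topology T X) X (\<lambda>(g, x). \<phi> g x)"

definition subflow ::
  "('g, 'm) monoid_scheme \<Rightarrow> 'x topology \<Rightarrow> ('g \<Rightarrow> 'x \<Rightarrow> 'x) \<Rightarrow> 'x set \<Rightarrow> bool" where
  "subflow G X \<phi> Y \<longleftrightarrow> Y \<noteq> {} \<and> closedin X Y \<and> (\<forall>g\<in>carrier G. \<phi> g ` Y \<subseteq> Y)"

definition minimal_flow ::
  "('g, 'm) monoid_scheme \<Rightarrow> 'x topology \<Rightarrow> ('g \<Rightarrow> 'x \<Rightarrow> 'x) \<Rightarrow> bool" where
  "minimal_flow G X \<phi> \<longleftrightarrow> (\<forall>Y. subflow G X \<phi> Y \<longrightarrow> Y = topspace X)"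

definition AP :: "('g, 'm) monoid_scheme \<Rightarrow> 'x topology \<Rightarrow> ('g \<Rightarrow> 'x \<Rightarrow> 'x) \<Rightarrow> 'x set" where
  "AP G X \<phi> = {x \<in> topspace X. minimal_flow G (subtopology X (X closure_of orbit G \<phi> x)) \<phi>}"

text \<open>HOL cannot quantify over all types inside a formula, so the type \<open>'x\<close> of the points of the
  flows is an explicit parameter. Theorem \<open>CAP_universal\<close> below shows that the instance
  \<^term>\<open>TYPE('g \<Rightarrow> real)\<close>, where \<open>'g\<close> is the type of the group elements, implies every other
  instance; so that instance expresses the property for all flows whatsoever.\<close>

definition CAP :: "'x itself \<Rightarrow> ('g, 'm) monoid_scheme \<Rightarrow> 'g topology \<Rightarrow> bool" where
  "CAP (_ :: 'x itself) G T \<longleftrightarrow>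
     (\<forall>(X :: 'x topology) \<phi>. flow G T X \<phi> \<longrightarrow> closedin X (AP G X \<phi>))"

text \<open>The pair \<open>(i, j) \<in> r\<close> means \<open>i \<le> j\<close>, and \<open>\<pi> i j\<close> is the bonding map from \<open>G j\<close> to \<open>G i\<close>.
  As usual for directed sets, antisymmetry of \<open>r\<close> is not required.\<close>

locale inverse_system =
  fixes I :: "'i set" and r :: "('i \<times> 'i) set"
    and G :: "'i \<Rightarrow> ('g, 'm) monoid_scheme" and T :: "'i \<Rightarrow> 'g topology"
    and \<pi> :: "'i \<Rightarrow> 'i \<Rightarrow> 'g \<Rightarrow> 'g"
  assumes index_nonempty: "I \<noteq> {}"
    and index_preorder: "preorder_on I r"
    and index_directed: "\<And>i j. i \<in> I \<Longrightarrow> j \<in> I \<Longrightarrow> \<exists>k\<in>I. (i, k) \<in> r \<and> (j, k) \<in> r"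
    and groups: "\<And>i. i \<in> I \<Longrightarrow> topological_group (G i) (T i)"
    and bonding_hom: "\<And>i j. (i, j) \<in> r \<Longrightarrow> \<pi> i j \<in> hom (G j) (G i)"
    and bonding_continuous: "\<And>i j. (i, j) \<in> r \<Longrightarrow> continuous_map (T j) (T i) (\<pi> i j)"
    and bonding_id: "\<And>i x. i \<in> I \<Longrightarrow> x \<in> carrier (G i) \<Longrightarrow> \<pi> i i x = x"
    and bonding_comp: "\<And>i j k x. (i, j) \<in> r \<Longrightarrow> (j, k) \<in> r \<Longrightarrow> x \<in> carrier (G k) \<Longrightarrow>
                         \<pi> i j (\<pi> j k x) = \<pi> i k x"

definition inverse_limit ::
  "'i set \<Rightarrow> ('i \<times> 'i) set \<Rightarrow> ('i \<Rightarrow> ('g, 'm) monoid_scheme) \<Rightarrow> ('i \<Rightarrow> 'i \<Rightarrow> 'g \<Rightarrow> 'g)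
    \<Rightarrow> ('i \<Rightarrow> 'g) monoid" where
  "inverse_limit I r G \<pi> =
     (product_group I G)
       \<lparr>carrier := {g \<in> carrier (product_group I G). \<forall>(i, j)\<in>r. \<pi> i j (g j) = g i}\<rparr>"

definition inverse_limit_topology ::
  "'i set \<Rightarrow> ('i \<times> 'i) set \<Rightarrow> ('i \<Rightarrow> ('g, 'm) monoid_scheme) \<Rightarrow> ('i \<Rightarrow> 'g topology)
    \<Rightarrow> ('i \<Rightarrow> 'i \<Rightarrow> 'g \<Rightarrow> 'g) \<Rightarrow> ('i \<Rightarrow> 'g) topology" where
  "inverse_limit_topology I r G T \<pi> =
     subtopology (product_topology T I) (carrier (inverse_limit I r G \<pi>))"

locale surjective_inverse_system = inverse_system +
  assumes projection_surj: "\<And>i. i \<in> I \<Longrightarrow> (\<lambda>g. g i) ` carrier (inverse_limit I r G \<pi>) = carrier (G i)"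


section \<open>Independence of the type of points\<close>

lemma flow_action_continuous:
  assumes "topological_group G T" "flow G T X \<phi>" "g \<in> carrier G"
  shows "continuous_map X X (\<phi> g)"
proof -
  have "continuous_map X (prod_topology T X) (\<lambda>z. (g, z))"
    using assms(3) topological_group.topspace_eq_carrier[OF assms(1)]
    by (intro continuous_map_pairedI) auto
  then have "continuous_map X X ((\<lambda>(g, x). \<phi> g x) \<circ> (\<lambda>z. (g, z)))"
    using assms continuous_map_compose flow_def by metis
  then show ?thesis by (simp add: o_def)
qed

lemma orbit_closure_invariant:
  assumes TG: "topological_group G T" and F: "flow G T X \<phi>" and x: "x \<in> topspace X"
    and g: "g \<in> carrier G"
  shows "\<phi> g ` (X closure_of orbit G \<phi> x) \<subseteq> X closure_of orbit G \<phi> x"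
proof -
  interpret group_action G "topspace X" \<phi> using F by (simp add: flow_def)
  interpret TG: topological_group G T by fact
  have "\<phi> g ` orbit G \<phi> x \<subseteq> orbit G \<phi> x"
  proof (clarsimp simp: orbit_def)
    fix h assume h: "h \<in> carrier G"
    show "\<exists>k. \<phi> g (\<phi> h x) = \<phi> k x \<and> k \<in> carrier G"
      using composition_rule[OF x g h] g h by (intro exI[of _ "g \<otimes>\<^bsub>G\<^esub> h"]) auto
  qed
  then show ?thesis
    using continuous_map_image_closure_subset[OF flow_action_continuous[OF TG F g]]
      closure_of_mono by (metis order_trans)
qed

lemma AP_iff:
  assumes TG: "topological_group G T" and F: "flow G T X \<phi>"
  shows "x \<in> AP G X \<phi> \<longleftrightarrow> x \<in> topspace X \<and>
           (\<forall>Y. subflow G X \<phi> Y \<and> Y \<subseteq> X closure_of orbit G \<phi> x \<longrightarrow> x \<in> Y)"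
proof (cases "x \<in> topspace X")
  case True
  interpret group_action G "topspace X" \<phi> using F by (simp add: flow_def)
  let ?C = "X closure_of orbit G \<phi> x"
  have orb: "orbit G \<phi> x \<subseteq> topspace X"
    using True element_image by (auto simp: orbit_def)
  have xC: "x \<in> ?C"
    using orbit_refl[OF True] closure_of_subset[OF orb] by auto
  have sub: "subflow G (subtopology X ?C) \<phi> Y \<longleftrightarrow> subflow G X \<phi> Y \<and> Y \<subseteq> ?C" for Y
    by (auto simp: subflow_def closedin_closed_subtopology)
  have eq: "Y = ?C \<longleftrightarrow> x \<in> Y" if Y: "subflow G X \<phi> Y" "Y \<subseteq> ?C" for Y
  proof
    assume "x \<in> Y"
    then have "orbit G \<phi> x \<subseteq> Y" using Y by (auto simp: orbit_def subflow_def)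
    then have "?C \<subseteq> Y" using Y by (simp add: closure_of_minimal subflow_def)
    then show "Y = ?C" using Y by auto
  qed (use xC in auto)
  have "topspace (subtopology X ?C) = ?C"
    by (simp add: closure_of_subset_topspace Int_absorb1)
  then have "x \<in> AP G X \<phi> \<longleftrightarrow> (\<forall>Y. subflow G X \<phi> Y \<and> Y \<subseteq> ?C \<longrightarrow> Y = ?C)"
    unfolding AP_def minimal_flow_def mem_Collect_eq sub using True by auto
  then show ?thesis using True eq by auto
qed (simp add: AP_def)

lemma factor_AP:
  assumes TG: "topological_group G T" and FX: "flow G T X \<phi>" and FZ: "flow G T Z \<psi>"
    and cF: "continuous_map X Z F"
    and eqv: "\<And>g x. g \<in> carrier G \<Longrightarrow> x \<in> topspace X \<Longrightarrow> F (\<phi> g x) = \<psi> g (F x)"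
    and x: "x \<in> AP G X \<phi>"
  shows "F x \<in> AP G Z \<psi>"
proof -
  let ?C = "X closure_of orbit G \<phi> x"
  have xX: "x \<in> topspace X" using x by (simp add: AP_def)
  have Fx: "F x \<in> topspace Z" using cF xX by (auto simp: continuous_map_def)
  interpret group_action G "topspace X" \<phi> using FX by (simp add: flow_def)
  have orb: "orbit G \<phi> x \<subseteq> topspace X"
    using xX element_image by (auto simp: orbit_def)
  have orbC: "orbit G \<phi> x \<subseteq> ?C" using closure_of_subset[OF orb] .
  have "closed_map X Z F"
    using continuous_imp_closed_map FX FZ cF by (auto simp: flow_def)
  then have clFC: "closedin Z (F ` ?C)"
    by (simp add: closed_map_def)
  have "orbit G \<psi> (F x) \<subseteq> F ` ?C"
  proof
    fix w assume "w \<in> orbit G \<psi> (F x)"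
    then obtain g where g: "g \<in> carrier G" "w = \<psi> g (F x)" by (auto simp: orbit_def)
    then have "w = F (\<phi> g x)" using eqv xX by auto
    moreover have "\<phi> g x \<in> ?C" using orbC g by (auto simp: orbit_def)
    ultimately show "w \<in> F ` ?C" by auto
  qed
  then have sub: "Z closure_of orbit G \<psi> (F x) \<subseteq> F ` ?C"
    using clFC by (simp add: closure_of_minimal)
  have "F x \<in> W" if W: "subflow G Z \<psi> W" "W \<subseteq> Z closure_of orbit G \<psi> (F x)" for W
  proof -
    let ?Y = "{y \<in> topspace X. F y \<in> W} \<inter> ?C"
    have "closedin X ?Y"
      using W cF by (intro closedin_Int closedin_continuous_map_preimage[of X Z])
        (auto simp: subflow_def)
    moreover have "?Y \<noteq> {}"
    proof -
      obtain w where w: "w \<in> W" using W by (auto simp: subflow_def)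
      then obtain y where "y \<in> ?C" "w = F y" using W sub by auto
      then show ?thesis using w closure_of_subset_topspace[of X "orbit G \<phi> x"] by auto
    qed
    moreover have "\<phi> g ` ?Y \<subseteq> ?Y" if g: "g \<in> carrier G" for g
      using orbit_closure_invariant[OF TG FX xX g] W g eqv element_image
      by (fastforce simp: subflow_def image_subset_iff)
    ultimately have "subflow G X \<phi> ?Y" by (auto simp: subflow_def)
    then have "x \<in> ?Y" using x AP_iff[OF TG FX] by blast
    then show ?thesis by auto
  qed
  then show ?thesis using AP_iff[OF TG FZ] Fx by blast
qed

lemma function_factor:
  fixes G :: "('g, 'm) monoid_scheme" and X :: "'x topology" and f :: "'x \<Rightarrow> real"
  assumes TG: "topological_group G T" and FX: "flow G T X \<phi>"
    and f: "continuous_map X euclideanreal f"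
  defines "F \<equiv> \<lambda>z. \<lambda>g\<in>carrier G. f (\<phi> g z)"
  obtains Z :: "('g \<Rightarrow> real) topology" and \<psi> where "flow G T Z \<psi>" "continuous_map X Z F"
    "\<And>g x. g \<in> carrier G \<Longrightarrow> x \<in> topspace X \<Longrightarrow> F (\<phi> g x) = \<psi> g (F x)"
proof -
  interpret TG: topological_group G T by fact
  interpret act: group_action G "topspace X" \<phi> using FX by (simp add: flow_def)
  let ?C = "carrier G"
  define P where "P = product_topology (\<lambda>_. euclideanreal) ?C"
  define S where "S = F ` topspace X"
  define Z where "Z = subtopology P S"
  define \<psi> where "\<psi> = (\<lambda>h. \<lambda>w\<in>S. \<lambda>g\<in>?C. w (g \<otimes>\<^bsub>G\<^esub> h))"
  have actc: "continuous_map X X (\<phi> g)" if "g \<in> ?C" for g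
    using flow_action_continuous[OF TG FX that] .
  have contFP: "continuous_map X P F"
    unfolding P_def
  proof (subst continuous_map_componentwise, intro conjI ballI)
    show "F ` topspace X \<subseteq> extensional ?C" by (auto simp: F_def)
    fix k assume k: "k \<in> ?C"
    have "continuous_map X euclideanreal (f \<circ> \<phi> k)"
      using actc[OF k] f continuous_map_compose by blast
    then show "continuous_map X euclideanreal (\<lambda>x. F x k)"
      using k by (simp add: F_def o_def)
  qed
  have topZ: "topspace Z = S"
    using contFP unfolding Z_def S_def by (auto simp: continuous_map_def)
  have contFZ: "continuous_map X Z F"
    unfolding Z_def S_def using contFP by (auto simp: continuous_map_in_subtopology)
  have "Hausdorff_space P"
    unfolding P_def by (simp add: Hausdorff_space_product_topology)
  then have HZ: "Hausdorff_space Z" unfolding Z_def by (rule Hausdorff_space_subtopology)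
  have cX: "compact_space X" and neX: "topspace X \<noteq> {}"
    and cact: "continuous_map (prod_topology T X) X (\<lambda>(g, x). \<phi> g x)"
    using FX by (auto simp: flow_def)
  have "compactin Z S"
    using image_compactin[OF _ contFZ] cX by (simp add: S_def compact_space_def)
  then have cZ: "compact_space Z" by (simp add: compact_space_def topZ)
  have eqv: "\<psi> h (F z) = F (\<phi> h z)" if h: "h \<in> ?C" and z: "z \<in> topspace X" for h z
  proof -
    have "F z \<in> S" using z by (simp add: S_def)
    then show ?thesis
      using h z act.composition_rule[OF z _ h] by (auto simp: \<psi>_def F_def fun_eq_iff)
  qed
  have inS: "\<psi> h w \<in> S" if "h \<in> ?C" "w \<in> S" for h w
    using that eqv act.element_image unfolding S_def by fastforce
  have comp: "\<psi> (h \<otimes>\<^bsub>G\<^esub> k) w = \<psi> h (\<psi> k w)" if hk: "h \<in> ?C" "k \<in> ?C" and w: "w \<in> S" for h k w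
  proof -
    obtain z where z: "z \<in> topspace X" "w = F z" using w by (auto simp: S_def)
    have "\<phi> k z \<in> topspace X" by (rule act.element_image[OF hk(2) z(1) refl])
    then show ?thesis using z hk eqv act.composition_rule[OF z(1) hk] by simp
  qed
  have one: "\<psi> \<one>\<^bsub>G\<^esub> w = w" if w: "w \<in> S" for w
  proof -
    obtain z where z: "z \<in> topspace X" "w = F z" using w by (auto simp: S_def)
    have "\<phi> \<one>\<^bsub>G\<^esub> z = z" using act.id_eq_one z(1) by (metis restrict_apply')
    then show ?thesis using z eqv by simp
  qed
  have Bij: "\<psi> h \<in> Bij S" if h: "h \<in> ?C" for h
  proof -
    have "bij_betw (\<psi> h) S S"
    proof (rule bij_betw_byWitness[where f' = "\<psi> (inv\<^bsub>G\<^esub> h)"])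
      show "\<forall>a\<in>S. \<psi> (inv\<^bsub>G\<^esub> h) (\<psi> h a) = a"
        using comp[of "inv\<^bsub>G\<^esub> h" h] one h by auto
      show "\<forall>a\<in>S. \<psi> h (\<psi> (inv\<^bsub>G\<^esub> h) a) = a"
        using comp[of h "inv\<^bsub>G\<^esub> h"] one h by auto
    qed (use inS h in auto)
    then show ?thesis by (simp add: Bij_def \<psi>_def)
  qed
  have "group_action G S \<psi>"
  proof (intro group_action.intro group_hom.intro group_hom_axioms.intro)
    show "\<psi> \<in> hom G (BijGroup S)"
    proof (rule homI)
      fix h assume "h \<in> ?C" then show "\<psi> h \<in> carrier (BijGroup S)"
        using Bij by (simp add: BijGroup_def)
    next
      fix h k assume hk: "h \<in> ?C" "k \<in> ?C"
      have "\<psi> (h \<otimes>\<^bsub>G\<^esub> k) = compose S (\<psi> h) (\<psi> k)"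
      proof
        fix w show "\<psi> (h \<otimes>\<^bsub>G\<^esub> k) w = compose S (\<psi> h) (\<psi> k) w"
        proof (cases "w \<in> S")
          case False then show ?thesis by (simp add: compose_def \<psi>_def)
        qed (use comp hk in \<open>simp add: compose_def\<close>)
      qed
      then show "\<psi> (h \<otimes>\<^bsub>G\<^esub> k) = \<psi> h \<otimes>\<^bsub>BijGroup S\<^esub> \<psi> k"
        using Bij hk by (simp add: BijGroup_def)
    qed
  qed (rule TG.is_group group_BijGroup)+
  moreover have "continuous_map (prod_topology T Z) Z (\<lambda>(g, w). \<psi> g w)"
  proof -
    let ?q = "\<lambda>(g, x). (id g, F x)"
    have "proper_map X Z F"
      by (rule continuous_imp_proper_map) (use cX HZ contFZ Hausdorff_imp_kc_space in auto)
    then have "proper_map (prod_topology T X) (prod_topology T Z) ?q"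
      unfolding proper_map_prod using proper_map_id by blast
    then have "closed_map (prod_topology T X) (prod_topology T Z) ?q"
      by (rule proper_imp_closed_map)
    moreover have "continuous_map (prod_topology T X) (prod_topology T Z) ?q"
      unfolding continuous_map_prod_top using contFZ continuous_map_id by blast
    moreover have "?q ` topspace (prod_topology T X) = topspace (prod_topology T Z)"
      by (force simp: topZ S_def)
    ultimately have q: "quotient_map (prod_topology T X) (prod_topology T Z) ?q"
      using continuous_closed_imp_quotient_map by blast
    have "continuous_map (prod_topology T X) Z (F \<circ> (\<lambda>(g, x). \<phi> g x))"
      using cact contFZ continuous_map_compose by blast
    then have "continuous_map (prod_topology T X) Z ((\<lambda>(g, w). \<psi> g w) \<circ> ?q)"
      by (rule continuous_map_eq) (auto simp: eqv TG.topspace_eq_carrier)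
    then show ?thesis using continuous_compose_quotient_map[OF q] by blast
  qed
  ultimately have "flow G T Z \<psi>"
    using cZ HZ neX by (simp add: flow_def topZ S_def)
  then show ?thesis using that contFZ eqv by metis
qed

theorem CAP_universal:
  fixes G :: "('g, 'm) monoid_scheme"
  assumes TG: "topological_group G T" and cap: "CAP TYPE('g \<Rightarrow> real) G T"
  shows "CAP TYPE('x) G T"
  unfolding CAP_def
proof (intro allI impI)
  fix X :: "'x topology" and \<phi> assume FX: "flow G T X \<phi>"
  interpret TG: topological_group G T by fact
  interpret act: group_action G "topspace X" \<phi> using FX by (simp add: flow_def)
  have APsub: "AP G X \<phi> \<subseteq> topspace X" by (auto simp: AP_def)
  have "X closure_of AP G X \<phi> \<subseteq> AP G X \<phi>"
  proof
    fix x assume x: "x \<in> X closure_of AP G X \<phi>"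
    then have xX: "x \<in> topspace X" using closure_of_subset_topspace by fastforce
    have "x \<in> Y" if Y: "subflow G X \<phi> Y" "Y \<subseteq> X closure_of orbit G \<phi> x" for Y
    proof (rule ccontr)
      assume nx: "x \<notin> Y"
      have H: "Hausdorff_space X" "compact_space X" using FX by (auto simp: flow_def)
      then have n: "normal_space X" by (simp add: compact_Hausdorff_or_regular_imp_normal_space)
      have "closedin X {x}" using H xX by (simp add: closedin_Hausdorff_singleton)
      moreover have "closedin X Y" "disjnt Y {x}" using Y nx by (auto simp: subflow_def disjnt_def)
      ultimately obtain f where f: "continuous_map X euclideanreal f" "f ` Y \<subseteq> {0::real}" "f ` {x} \<subseteq> {1}"
        using Urysohn_lemma_alt[OF n] by metis
      define F where "F = (\<lambda>z. \<lambda>g\<in>carrier G. f (\<phi> g z))"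
      obtain Z :: "('g \<Rightarrow> real) topology" and \<psi> where FZ: "flow G T Z \<psi>"
        and cF: "continuous_map X Z F"
        and eqv: "\<And>g x. g \<in> carrier G \<Longrightarrow> x \<in> topspace X \<Longrightarrow> F (\<phi> g x) = \<psi> g (F x)"
        using function_factor[OF TG FX f(1)] unfolding F_def by metis
      have "closedin Z (AP G Z \<psi>)" using cap FZ by (simp add: CAP_def)
      moreover have "F ` AP G X \<phi> \<subseteq> AP G Z \<psi>"
        using factor_AP[OF TG FX FZ cF eqv] by auto
      moreover have "F x \<in> Z closure_of (F ` AP G X \<phi>)"
        using continuous_map_image_closure_subset[OF cF] x by blast
      ultimately have FxAP: "F x \<in> AP G Z \<psi>"
        using closure_of_minimal by blast
      have "closed_map X Z F"
        using continuous_imp_closed_map FX FZ cF by (auto simp: flow_def)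
      then have clY: "closedin Z (F ` Y)" using Y by (simp add: closed_map_def subflow_def)
      have YX: "Y \<subseteq> topspace X" using Y closedin_subset by (auto simp: subflow_def)
      have inv: "\<psi> g ` F ` Y \<subseteq> F ` Y" if g: "g \<in> carrier G" for g
      proof clarify
        fix y assume y: "y \<in> Y"
        then have "\<psi> g (F y) = F (\<phi> g y)" using eqv g YX by auto
        moreover have "\<phi> g y \<in> Y" using Y g y by (auto simp: subflow_def)
        ultimately show "\<psi> g (F y) \<in> F ` Y" by auto
      qed
      have sub: "subflow G Z \<psi> (F ` Y)" using Y clY inv by (auto simp: subflow_def)
      have "F ` orbit G \<phi> x \<subseteq> orbit G \<psi> (F x)"
        using eqv xX by (auto simp: orbit_def)
      then have "F ` (X closure_of orbit G \<phi> x) \<subseteq> Z closure_of orbit G \<psi> (F x)"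
        using continuous_map_image_closure_subset[OF cF, of "orbit G \<phi> x"] closure_of_mono
        by (metis order_trans)
      then have "F ` Y \<subseteq> Z closure_of orbit G \<psi> (F x)" using Y by auto
      then have "F x \<in> F ` Y" using FxAP AP_iff[OF TG FZ] sub by blast
      then obtain y where y: "y \<in> Y" "F x = F y" by auto
      have one: "\<phi> \<one>\<^bsub>G\<^esub> z = z" if "z \<in> topspace X" for z
        using act.id_eq_one that by (metis restrict_apply')
      have "F x \<one>\<^bsub>G\<^esub> = 1" using f one xX by (simp add: F_def)
      moreover have "y \<in> topspace X" "f y = 0" using f(2) y(1) YX by auto
      then have "F y \<one>\<^bsub>G\<^esub> = 0" using one by (simp add: F_def)
      ultimately show False using y by simp
    qed
    then show "x \<in> AP G X \<phi>" using AP_iff[OF TG FX] xX by blast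
  qed
  then show "closedin X (AP G X \<phi>)"
    using APsub closure_of_subset_eq by blast
qed


section \<open>The inverse limit is a topological group\<close>

context inverse_system
begin

lemma subgroup_inverse_limit:
  "subgroup (carrier (inverse_limit I r G \<pi>)) (product_group I G)"
proof -
  let ?P = "product_group I G"
  let ?L = "carrier (inverse_limit I r G \<pi>)"
  have grp: "group (G i)" if "i \<in> I" for i
    using groups[OF that] by (simp add: topological_group_def)
  have idx: "i \<in> I" "j \<in> I" if "(i, j) \<in> r" for i j
    using index_preorder that by (auto simp: preorder_on_def)
  have hom: "group_hom (G j) (G i) (\<pi> i j)" if "(i, j) \<in> r" for i j
    using that idx[OF that] grp bonding_hom by (simp add: group_hom_def group_hom_axioms_def)
  have memL: "g \<in> ?L \<longleftrightarrow> g \<in> carrier ?P \<and> (\<forall>i j. (i, j) \<in> r \<longrightarrow> \<pi> i j (g j) = g i)" for g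
    by (auto simp: inverse_limit_def)
  have comp: "g i \<in> carrier (G i)" if "g \<in> carrier ?P" "i \<in> I" for g i
    using that by auto
  interpret P: group ?P using grp by (rule product_group)
  show ?thesis
  proof (rule P.subgroupI)
    show "?L \<subseteq> carrier ?P" using memL by blast
    have "\<one>\<^bsub>?P\<^esub> \<in> ?L"
      unfolding memL using P.one_closed idx group_hom.hom_one[OF hom] by auto
    then show "?L \<noteq> {}" by blast
  next
    fix a assume "a \<in> ?L"
    then have a: "a \<in> carrier ?P" "\<And>i j. (i, j) \<in> r \<Longrightarrow> \<pi> i j (a j) = a i" by (auto simp: memL)
    have inva: "inv\<^bsub>?P\<^esub> a = (\<lambda>i\<in>I. inv\<^bsub>G i\<^esub> a i)"
      using a(1) grp by (intro inv_product_group) auto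
    have "\<pi> i j ((inv\<^bsub>?P\<^esub> a) j) = (inv\<^bsub>?P\<^esub> a) i" if ij: "(i, j) \<in> r" for i j
      using idx[OF ij] a(2)[OF ij] group_hom.hom_inv[OF hom[OF ij] comp[OF a(1)]]
      by (simp add: inva)
    then show "inv\<^bsub>?P\<^esub> a \<in> ?L" unfolding memL using P.inv_closed[OF a(1)] by blast
    fix b assume "b \<in> ?L"
    then have b: "b \<in> carrier ?P" "\<And>i j. (i, j) \<in> r \<Longrightarrow> \<pi> i j (b j) = b i" by (auto simp: memL)
    have "\<pi> i j ((a \<otimes>\<^bsub>?P\<^esub> b) j) = (a \<otimes>\<^bsub>?P\<^esub> b) i" if ij: "(i, j) \<in> r" for i j
      using idx[OF ij] a(2)[OF ij] b(2)[OF ij]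
        group_hom.hom_mult[OF hom[OF ij] comp[OF a(1)] comp[OF b(1)]]
      by simp
    then show "a \<otimes>\<^bsub>?P\<^esub> b \<in> ?L" unfolding memL using P.m_closed[OF a(1) b(1)] by blast
  qed
qed

lemma topological_group_inverse_limit:
  "topological_group (inverse_limit I r G \<pi>) (inverse_limit_topology I r G T \<pi>)"
proof -
  let ?P = "product_group I G"
  let ?L = "inverse_limit I r G \<pi>"
  let ?T = "inverse_limit_topology I r G T \<pi>"
  have grp: "group (G i)" if "i \<in> I" for i
    using groups[OF that] by (simp add: topological_group_def)
  have top: "topspace (T i) = carrier (G i)" if "i \<in> I" for i
    using topological_group.topspace_eq_carrier[OF groups[OF that]] .
  interpret P: group ?P using grp by (rule product_group)
  interpret S: subgroup "carrier ?L" ?P by (rule subgroup_inverse_limit)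
  have L: "?L = ?P\<lparr>carrier := carrier ?L\<rparr>" by (simp add: inverse_limit_def)
  have mult: "(\<otimes>\<^bsub>?L\<^esub>) = (\<otimes>\<^bsub>?P\<^esub>)" by (simp add: inverse_limit_def)
  have grpL: "group ?L" using S.subgroup_is_group[OF P.is_group] L by simp
  have topP: "topspace (product_topology T I) = carrier ?P"
    using top by (auto simp: PiE_iff)
  have topL: "topspace ?T = carrier ?L"
    using S.subset unfolding inverse_limit_topology_def topspace_subtopology topP by blast
  have proj: "continuous_map ?T (T i) (\<lambda>g. g i)" if "i \<in> I" for i
    unfolding inverse_limit_topology_def
    using that by (intro continuous_map_from_subtopology continuous_map_product_projection)
  have into: "continuous_map Z ?T f"
    if "f ` topspace Z \<subseteq> carrier ?L" "\<And>i. i \<in> I \<Longrightarrow> continuous_map Z (T i) (\<lambda>z. f z i)"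
    for Z :: "'z topology" and f
  proof -
    have "f ` topspace Z \<subseteq> extensional I"
      using that(1) S.subset by (fastforce simp: PiE_def)
    then have "continuous_map Z (product_topology T I) f"
      using that(2) by (simp add: continuous_map_componentwise)
    then show ?thesis
      unfolding inverse_limit_topology_def continuous_map_in_subtopology using that(1) by auto
  qed
  show ?thesis
  proof (intro topological_group.intro topological_group_axioms.intro)
    show "Hausdorff_space ?T"
      unfolding inverse_limit_topology_def
      using topological_group.Hausdorff[OF groups]
      by (intro Hausdorff_space_subtopology) (simp add: Hausdorff_space_product_topology)
    show "continuous_map (prod_topology ?T ?T) ?T (\<lambda>(x, y). x \<otimes>\<^bsub>?L\<^esub> y)"
    proof (rule into)
      show "(\<lambda>(x, y). x \<otimes>\<^bsub>?L\<^esub> y) ` topspace (prod_topology ?T ?T) \<subseteq> carrier ?L"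
        using monoid.m_closed[OF group.is_monoid[OF grpL]] by (auto simp: topL)
      fix i assume i: "i \<in> I"
      have "continuous_map (prod_topology ?T ?T) (T i) ((\<lambda>g. g i) \<circ> fst)"
        "continuous_map (prod_topology ?T ?T) (T i) ((\<lambda>g. g i) \<circ> snd)"
        using proj[OF i] continuous_map_fst continuous_map_snd continuous_map_compose by blast+
      then have "continuous_map (prod_topology ?T ?T) (prod_topology (T i) (T i))
                   (\<lambda>z. (fst z i, snd z i))"
        by (intro continuous_map_pairedI) (simp_all add: o_def)
      from continuous_map_compose[OF this topological_group.continuous_mult[OF groups[OF i]]]
      show "continuous_map (prod_topology ?T ?T) (T i) (\<lambda>z. (case z of (x, y) \<Rightarrow> x \<otimes>\<^bsub>?L\<^esub> y) i)"
        using i by (simp add: o_def mult case_prod_unfold)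
    qed
    show "continuous_map ?T ?T (\<lambda>x. inv\<^bsub>?L\<^esub> x)"
    proof (rule into)
      show "(\<lambda>x. inv\<^bsub>?L\<^esub> x) ` topspace ?T \<subseteq> carrier ?L"
        using group.inv_closed[OF grpL] by (auto simp: topL)
      fix i assume i: "i \<in> I"
      have eq: "inv\<^bsub>G i\<^esub> (x i) = (inv\<^bsub>?L\<^esub> x) i" if x: "x \<in> carrier ?L" for x
      proof -
        have "inv\<^bsub>?L\<^esub> x = inv\<^bsub>?P\<^esub> x"
          using P.m_inv_consistent[OF subgroup_inverse_limit x] L by simp
        also have "\<dots> = (\<lambda>i\<in>I. inv\<^bsub>G i\<^esub> x i)"
          using S.mem_carrier[OF x] grp by (intro inv_product_group) auto
        finally show ?thesis using i by simp
      qed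
      have "continuous_map ?T (T i) ((\<lambda>x. inv\<^bsub>G i\<^esub> x) \<circ> (\<lambda>g. g i))"
        using proj[OF i] topological_group.continuous_inv[OF groups[OF i]]
        by (rule continuous_map_compose)
      then show "continuous_map ?T (T i) (\<lambda>x. (inv\<^bsub>?L\<^esub> x) i)"
        by (rule continuous_map_eq) (simp add: topL eq)
    qed
  qed (use grpL topL in auto)
qed

end

end

theory Submission
  imports Defs
begin

text \<open>
  Let \<open>L\<close> be the inverse limit, \<open>X\<close> an \<open>L\<close>-flow, and \<open>x\<close> a limit of almost periodic points. If
  \<open>x\<close> is not almost periodic, there is a subflow \<open>Y\<close> of its orbit closure that misses \<open>x\<close>, and a
  continuous \<open>f\<close> with \<open>f = 0\<close> on \<open>Y\<close> and \<open>f x = 1\<close>. The aim is a contradiction from a flow of a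
  single group \<open>G k\<close>. A quotient of \<open>X\<close> will not do, since the kernel of the projection to \<open>G k\<close> may
  act on \<open>X\<close> without any nonconstant invariant continuous function; a joining does.

  By compactness of \<open>X\<close>, \<open>f (u z)\<close> differs from \<open>f z\<close> by less than \<open>1/3\<close>, for all \<open>z\<close>, when \<open>u\<close> is in
  some neighbourhood of the identity of \<open>L\<close>. As the index set is directed, that neighbourhood
  contains the preimage of an identity neighbourhood \<open>V\<close> under the projection \<open>p\<close> to some \<open>G k\<close>
  (\<open>inverse_limit_neighbourhood_of_one\<close>). The Birkhoff--Kakutani construction gives a continuous
  length function on \<open>G k\<close> whose open unit ball lies in \<open>V\<close> (\<open>length_function_exists\<close>). The functions
  from \<open>G k\<close> to \<open>[0,1]\<close> that are 1-Lipschitz for it form, under right translation, a \<open>G k\<close>-flow \<open>Z\<close>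
  (\<open>flow_lipschitz\<close>). Let \<open>W\<close> be the closed invariant set of all pairs \<open>(z, h)\<close> in \<open>X \<times> Z\<close> such
  that, for every \<open>g\<close>, \<open>h (p g)\<close> is \<open>0\<close> if \<open>f (g z) < 1/3\<close> and is \<open>1\<close> if \<open>f (g z) > 2/3\<close>. The choice of
  \<open>V\<close> says exactly that the elements \<open>g\<close> of the first kind and those of the second kind have images
  at distance at least \<open>1\<close>, so the truncated distance to the first set is a suitable \<open>h\<close>, and \<open>W\<close>
  projects onto \<open>X\<close>.

  An almost periodic \<open>z\<close> has a partner \<open>h\<close> in \<open>W\<close> that is almost periodic too
  (\<open>AP_lifts_to_joining\<close>). Because \<open>p\<close> is onto, almost periodicity in \<open>Z\<close> means the same for \<open>L\<close> and
  for \<open>G k\<close>, so the almost periodic points of \<open>Z\<close> form a closed set and, by compactness, the limit \<open>x\<close>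
  has an almost periodic partner \<open>h\<close> as well. Moving \<open>x\<close> towards a point of \<open>Y\<close> moves \<open>h\<close> towards a
  partner of that point, which has to be the zero function as \<open>f = 0\<close> on \<open>Y\<close>. So the fixed
  point \<open>0\<close> is in the orbit closure of \<open>h\<close>, whence \<open>h = 0\<close>. But \<open>f x = 1\<close> makes \<open>h\<close> equal to \<open>1\<close> at the
  identity.

  The limit enters this argument through its identity neighbourhoods, which come from continuous
  surjections to groups with the closure property; \<open>CAP_if_approximated_by_CAP_groups\<close> is stated
  for all groups approximated in this way.
\<close>

section \<open>Length functions\<close>

text \<open>
  The topology enters only through \<open>small_near_one\<close>: with \<open>subadditive\<close>, continuity at the identity
  gives uniform continuity. In particular \<open>small_near_one\<close> forces the value \<open>0\<close> at the identity.
\<close>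

locale length_function = topological_group G T for G (structure) and T +
  fixes l :: "'a \<Rightarrow> real"
  assumes nonneg: "g \<in> carrier G \<Longrightarrow> 0 \<le> l g"
    and symmetric: "g \<in> carrier G \<Longrightarrow> l (inv g) = l g"
    and subadditive: "g \<in> carrier G \<Longrightarrow> h \<in> carrier G \<Longrightarrow> l (g \<otimes> h) \<le> l g + l h"
    and small_near_one: "e > 0 \<Longrightarrow> \<exists>V. openin T V \<and> \<one> \<in> V \<and> (\<forall>v\<in>V. l v < e)"

text \<open>
  Records a factorization of a group element into \<open>k\<close> factors, where a factor from \<open>U n\<close> costs
  \<open>(1/2) ^ n\<close> and the total cost is \<open>s\<close>. The least cost of a factorization is automatically
  subadditive.
\<close>

inductive dyadic_chain ::
  "('g, 'm) monoid_scheme \<Rightarrow> (nat \<Rightarrow> 'g set) \<Rightarrow> nat \<Rightarrow> real \<Rightarrow> 'g \<Rightarrow> bool" for G U where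
  empty: "dyadic_chain G U 0 0 \<one>\<^bsub>G\<^esub>"
| step: "dyadic_chain G U k s g \<Longrightarrow> u \<in> U n \<Longrightarrow>
           dyadic_chain G U (Suc k) (s + (1/2) ^ n) (g \<otimes>\<^bsub>G\<^esub> u)"

lemma dyadic_chain_nonneg: "dyadic_chain G U k s g \<Longrightarrow> 0 \<le> s"
  by (induction rule: dyadic_chain.induct) auto

context group
begin

lemma dyadic_chain_closed:
  assumes "\<And>n. U n \<subseteq> carrier G" "dyadic_chain G U k s g"
  shows "g \<in> carrier G"
  using assms(2,1) by (induction rule: dyadic_chain.induct) auto

lemma dyadic_chain_append:
  assumes U: "\<And>n. U n \<subseteq> carrier G" and a: "dyadic_chain G U j s a"
    and b: "dyadic_chain G U k t b"
  shows "dyadic_chain G U (j + k) (s + t) (a \<otimes> b)"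
  using b
proof (induction rule: dyadic_chain.induct)
  case empty
  then show ?case using a dyadic_chain_closed[OF U a] by simp
next
  case (step k t b u n)
  have "a \<otimes> (b \<otimes> u) = a \<otimes> b \<otimes> u"
    using dyadic_chain_closed[OF U a] dyadic_chain_closed[OF U step(1)] U step(2)
    by (metis m_assoc subsetD)
  then show ?case
    using dyadic_chain.step[OF step.IH step(2)] by (simp add: add.assoc)
qed

text \<open>
  The middle factor \<open>u\<close> is the one at which the running cost passes the threshold \<open>t\<close>.
\<close>

lemma dyadic_chain_split:
  assumes U: "\<And>n. U n \<subseteq> carrier G" and g: "dyadic_chain G U k s g" and t: "0 \<le> t" "t < s"
  shows "\<exists>a u b i j p q n. g = a \<otimes> u \<otimes> b \<and> dyadic_chain G U i p a \<and> u \<in> U n \<and>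
           dyadic_chain G U j q b \<and> i < k \<and> j < k \<and> p \<le> t \<and> t < p + (1/2) ^ n \<and>
           s = p + (1/2) ^ n + q"
  using g t(2)
proof (induction rule: dyadic_chain.induct)
  case empty
  then show ?case using t(1) by simp
next
  case (step k s g u n)
  show ?case
  proof (cases "t < s")
    case True
    then obtain a v b i j p q m where *: "g = a \<otimes> v \<otimes> b" "dyadic_chain G U i p a" "v \<in> U m"
      "dyadic_chain G U j q b" "i < k" "j < k" "p \<le> t" "t < p + (1/2) ^ m"
      "s = p + (1/2) ^ m + q"
      using step.IH by blast
    have "a \<in> carrier G" "b \<in> carrier G"
      using dyadic_chain_closed[OF U *(2)] dyadic_chain_closed[OF U *(4)] .
    moreover have "v \<in> carrier G" "u \<in> carrier G"
      using *(3) step(2) U by blast+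
    ultimately have "g \<otimes> u = a \<otimes> v \<otimes> (b \<otimes> u)" using *(1) by (simp add: m_assoc)
    moreover have "dyadic_chain G U (Suc j) (q + (1/2) ^ n) (b \<otimes> u)"
      using *(4) step(2) by (rule dyadic_chain.step)
    moreover have "s + (1/2) ^ n = p + (1/2) ^ m + (q + (1/2) ^ n)" using *(9) by simp
    moreover have "i < Suc k" "Suc j < Suc k" using * by auto
    ultimately show ?thesis using *(2,3,7,8) by blast
  next
    case False
    have "g \<in> carrier G" "u \<in> carrier G"
      using dyadic_chain_closed[OF U step(1)] step(2) U by blast+
    then have "g \<otimes> u = g \<otimes> u \<otimes> \<one>" by simp
    moreover have "s + (1/2) ^ n = s + (1/2) ^ n + 0" by simp
    moreover have "0 < Suc k" "k < Suc k" "s \<le> t" using False by auto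
    ultimately show ?thesis using step dyadic_chain.empty[of G U] by blast
  qed
qed

text \<open>
  Splitting at half of the total cost leaves two shorter chains, each of cost less than half of
  \<open>(1/2) ^ m\<close>, and a factor whose own cost is at most the total and, being a power of
  \<open>1/2\<close>, at most half of \<open>(1/2) ^ m\<close>. By induction all three pieces lie in \<open>U (Suc m)\<close>, which is why a condition on
  products of three elements is the right one.
\<close>

lemma dyadic_chain_bound:
  assumes U: "\<And>n. U n \<subseteq> carrier G" "\<And>n. \<one> \<in> U n"
    and cube: "\<And>n a b c. a \<in> U (Suc n) \<Longrightarrow> b \<in> U (Suc n) \<Longrightarrow> c \<in> U (Suc n) \<Longrightarrow> a \<otimes> b \<otimes> c \<in> U n"
  shows "dyadic_chain G U k s g \<Longrightarrow> s < (1/2) ^ m \<Longrightarrow> g \<in> U m"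
proof (induction k arbitrary: s g m rule: less_induct)
  case (less k)
  have "U (Suc n) \<subseteq> U n" for n
  proof
    fix a assume a: "a \<in> U (Suc n)"
    have "a \<otimes> \<one> \<otimes> \<one> \<in> U n" using cube[OF a U(2) U(2)] .
    moreover have "a \<in> carrier G" using a U(1) by blast
    ultimately show "a \<in> U n" by simp
  qed
  then have mono: "U n \<subseteq> U m" if "m \<le> n" for m n
    using lift_Suc_antimono_le[of U m n] that by blast
  show ?case
  proof (cases "s > 0")
    case False
    have "g = \<one>"
      using less.prems(1)
    proof cases
      case (step j t a u n)
      then have "0 < s" using dyadic_chain_nonneg[OF step(4)] by (simp add: add_nonneg_pos)
      then show ?thesis using False by simp
    qed simp
    then show ?thesis using U(2) by simp
  next
    case True
    then obtain a u b i j p q n where *: "g = a \<otimes> u \<otimes> b" "dyadic_chain G U i p a" "u \<in> U n"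
      "dyadic_chain G U j q b" "i < k" "j < k" "p \<le> s/2" "s/2 < p + (1/2) ^ n"
      "s = p + (1/2) ^ n + q"
      using dyadic_chain_split[OF U(1) less.prems(1), of "s/2"] by auto
    have pq: "0 \<le> p" "0 \<le> q"
      using dyadic_chain_nonneg[OF *(2)] dyadic_chain_nonneg[OF *(4)] .
    have "p < (1/2) ^ Suc m" "q < (1/2) ^ Suc m"
      using *(7-9) less.prems(2) by simp_all
    then have "a \<in> U (Suc m)" "b \<in> U (Suc m)"
      using less.IH[OF *(5) *(2)] less.IH[OF *(6) *(4)] by blast+
    moreover have "(1/2::real) ^ n < (1/2) ^ m" using *(9) pq less.prems(2) by linarith
    then have "m < n" by (simp add: power_strict_decreasing_iff)
    then have "u \<in> U (Suc m)" using mono[of "Suc m" n] *(3) by (simp add: Suc_le_eq subset_iff)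
    ultimately show ?thesis unfolding *(1) by (intro cube)
  qed
qed

end

context topological_group
begin

lemma square_neighbourhood:
  assumes "openin T U" "\<one> \<in> U"
  shows "\<exists>V. openin T V \<and> \<one> \<in> V \<and> (\<forall>a\<in>V. \<forall>b\<in>V. a \<otimes> b \<in> U)"
proof -
  let ?Q = "{z \<in> topspace (prod_topology T T). (case z of (x, y) \<Rightarrow> x \<otimes> y) \<in> U}"
  have openQ: "openin (prod_topology T T) ?Q"
    using continuous_mult assms(1) by (rule openin_continuous_map_preimage)
  have oneQ: "(\<one>, \<one>) \<in> ?Q" using assms by (simp add: topspace_eq_carrier)
  obtain A B where AB: "openin T A" "openin T B" "\<one> \<in> A" "\<one> \<in> B" "A \<times> B \<subseteq> ?Q"
    using openQ[unfolded openin_prod_topology_alt, rule_format, OF oneQ] by (elim exE conjE) (rule that)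
  have "a \<otimes> b \<in> U" if "a \<in> A \<inter> B" "b \<in> A \<inter> B" for a b
    using subsetD[OF AB(5), of "(a, b)"] that by simp
  moreover have "openin T (A \<inter> B)" "\<one> \<in> A \<inter> B" using AB(1-4) by auto
  ultimately show ?thesis by blast
qed

lemma cube_neighbourhood:
  assumes "openin T U" "\<one> \<in> U"
  shows "\<exists>V. openin T V \<and> \<one> \<in> V \<and> (\<forall>a\<in>V. \<forall>b\<in>V. \<forall>c\<in>V. a \<otimes> b \<otimes> c \<in> U)"
proof -
  obtain V where V: "openin T V" "\<one> \<in> V" "\<forall>a\<in>V. \<forall>b\<in>V. a \<otimes> b \<in> U"
    using square_neighbourhood[OF assms] by blast
  obtain W where W: "openin T W" "\<one> \<in> W" "\<forall>a\<in>W. \<forall>b\<in>W. a \<otimes> b \<in> V"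
    using square_neighbourhood[OF V(1,2)] by blast
  have "a \<otimes> b \<otimes> c \<in> U" if "a \<in> W \<inter> V" "b \<in> W \<inter> V" "c \<in> W \<inter> V" for a b c
    using V(3) W(3) that by simp
  moreover have "openin T (W \<inter> V)" "\<one> \<in> W \<inter> V"
    using V(1,2) W(1,2) by auto
  ultimately show ?thesis by blast
qed

text \<open>
  This is the Birkhoff--Kakutani construction: along a sequence of neighbourhoods
  in which each contains all triple products of the next, take the least cost of a factorization.
\<close>

lemma length_function_exists:
  assumes "openin T U" "\<one> \<in> U"
  obtains l where "length_function G T l" "\<And>g. g \<in> carrier G \<Longrightarrow> l g < 1 \<Longrightarrow> g \<in> U"
proof -
  have "\<exists>W. (\<forall>n. (openin T (W n) \<and> \<one> \<in> W n \<and> (n = 0 \<longrightarrow> W n = U)) \<and>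
          (\<forall>a\<in>W (Suc n). \<forall>b\<in>W (Suc n). \<forall>c\<in>W (Suc n). a \<otimes> b \<otimes> c \<in> W n))"
  proof (rule dependent_nat_choice[where P = "\<lambda>n V. openin T V \<and> \<one> \<in> V \<and> (n = 0 \<longrightarrow> V = U)"
        and Q = "\<lambda>n V V'. \<forall>a\<in>V'. \<forall>b\<in>V'. \<forall>c\<in>V'. a \<otimes> b \<otimes> c \<in> V"])
    fix V n assume "openin T V \<and> \<one> \<in> V \<and> (n = (0::nat) \<longrightarrow> V = U)"
    then obtain V' where "openin T V'" "\<one> \<in> V'"
      "\<forall>a\<in>V'. \<forall>b\<in>V'. \<forall>c\<in>V'. a \<otimes> b \<otimes> c \<in> V"
      using cube_neighbourhood[of V] by blast
    then show "\<exists>V'. (openin T V' \<and> \<one> \<in> V' \<and> (Suc n = 0 \<longrightarrow> V' = U)) \<and>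
        (\<forall>a\<in>V'. \<forall>b\<in>V'. \<forall>c\<in>V'. a \<otimes> b \<otimes> c \<in> V)"
      by auto
  qed (use assms in auto)
  then obtain W where W: "\<And>n. openin T (W n)" "\<And>n. \<one> \<in> W n" "W 0 = U"
    and cube: "\<And>n a b c. a \<in> W (Suc n) \<Longrightarrow> b \<in> W (Suc n) \<Longrightarrow> c \<in> W (Suc n) \<Longrightarrow> a \<otimes> b \<otimes> c \<in> W n"
    by metis
  have Wc: "W n \<subseteq> carrier G" for n
    using openin_subset[OF W(1)] topspace_eq_carrier by simp
  \<comment> \<open>The additional element \<open>1\<close> bounds the length and covers elements without any factorization.\<close>
  define S where "S = (\<lambda>g. insert 1 {s. \<exists>k. dyadic_chain G W k s g})"
  define m where "m = (\<lambda>g. Inf (S g))"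
  have S0: "0 \<le> s" if "s \<in> S g" for s g
    using that dyadic_chain_nonneg by (auto simp: S_def)
  then have bdd: "bdd_below (S g)" for g by (meson bdd_belowI)
  have ne: "S g \<noteq> {}" for g by (simp add: S_def)
  have m_le: "m g \<le> s" if "s \<in> S g" for s g
    unfolding m_def using that bdd by (rule cInf_lower)
  have m_greatest: "c \<le> m g" if "\<And>s. s \<in> S g \<Longrightarrow> c \<le> s" for c g
    unfolding m_def using ne that by (rule cInf_greatest)
  then have m0: "0 \<le> m g" for g using S0 by blast
  have m_add: "m (g \<otimes> h) \<le> m g + m h" if "g \<in> carrier G" "h \<in> carrier G" for g h
  proof -
    have *: "m (g \<otimes> h) \<le> s + t" if st: "s \<in> S g" "t \<in> S h" for s t
    proof (cases "s = 1 \<or> t = 1")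
      case True
      moreover have "m (g \<otimes> h) \<le> 1" by (rule m_le) (simp add: S_def)
      ultimately show ?thesis using S0[OF st(1)] S0[OF st(2)] by linarith
    next
      case False
      then obtain j k where "dyadic_chain G W j s g" "dyadic_chain G W k t h"
        using st by (auto simp: S_def)
      then have "s + t \<in> S (g \<otimes> h)"
        using dyadic_chain_append[where U = W, OF Wc] unfolding S_def by blast
      then show ?thesis by (rule m_le)
    qed
    have "m (g \<otimes> h) - t \<le> m g" if "t \<in> S h" for t
    proof (rule m_greatest)
      fix s assume "s \<in> S g"
      from *[OF this that] show "m (g \<otimes> h) - t \<le> s" by simp
    qed
    then have "m (g \<otimes> h) - m g \<le> t" if "t \<in> S h" for t
      using that by (simp add: algebra_simps)
    then have "m (g \<otimes> h) - m g \<le> m h" by (rule m_greatest)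
    then show ?thesis by simp
  qed
  have m_W: "m v \<le> (1/2) ^ n" if "v \<in> W n" for v n
  proof -
    have "dyadic_chain G W (Suc 0) (0 + (1/2) ^ n) (\<one> \<otimes> v)"
      using dyadic_chain.empty that by (rule dyadic_chain.step)
    moreover have "v \<in> carrier G" using Wc that by blast
    ultimately have "(1/2) ^ n \<in> S v" by (auto simp: S_def)
    then show ?thesis by (rule m_le)
  qed
  have m_U: "g \<in> U" if g: "m g < 1" for g
  proof -
    obtain s where "s \<in> S g" "s < 1"
      using g cInf_lessD[OF ne, of g 1] by (auto simp: m_def)
    then obtain k where "dyadic_chain G W k s g" "s < (1/2) ^ 0" by (auto simp: S_def)
    then show ?thesis using dyadic_chain_bound[where U = W, OF Wc W(2) cube] W(3) by blast
  qed
  \<comment> \<open>The sets \<open>W n\<close> need not be symmetric, so symmetry is forced by a maximum.\<close>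
  have "length_function G T (\<lambda>g. max (m g) (m (inv g)))"
  proof (unfold_locales)
    fix g assume g: "g \<in> carrier G"
    show "0 \<le> max (m g) (m (inv g))" using m0 by (simp add: le_max_iff_disj)
    show "max (m (inv g)) (m (inv (inv g))) = max (m g) (m (inv g))"
      using g by (simp add: max.commute)
    fix h assume h: "h \<in> carrier G"
    show "max (m (g \<otimes> h)) (m (inv (g \<otimes> h))) \<le> max (m g) (m (inv g)) + max (m h) (m (inv h))"
      using m_add[OF g h] m_add[of "inv h" "inv g"] g h by (simp add: inv_mult_group max_def)
  next
    fix e :: real assume "e > 0"
    then obtain n where n: "(1/2) ^ n < e" using real_arch_pow_inv[of e "1/2::real"] by auto
    have "max (m v) (m (inv v)) < e" if "v \<in> W n" "inv v \<in> W n" for v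
      using m_W[OF that(1)] m_W[OF that(2)] n by simp
    moreover have "openin T (W n \<inter> {v \<in> topspace T. inv v \<in> W n})"
      using continuous_inv W(1) by (intro openin_Int openin_continuous_map_preimage)
    ultimately show "\<exists>V. openin T V \<and> \<one> \<in> V \<and> (\<forall>v\<in>V. max (m v) (m (inv v)) < e)"
      using W(2) by (intro exI[of _ "W n \<inter> {v \<in> topspace T. inv v \<in> W n}"])
        (auto simp: topspace_eq_carrier)
  qed
  then show ?thesis by (rule that) (use m_U in auto)
qed

end

section \<open>Flows of Lipschitz functions\<close>

lemma group_actionI:
  assumes "group G" and ext: "\<And>g. g \<in> carrier G \<Longrightarrow> \<psi> g \<in> extensional S"
    and closed: "\<And>g w. g \<in> carrier G \<Longrightarrow> w \<in> S \<Longrightarrow> \<psi> g w \<in> S"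
    and mult: "\<And>g h w. g \<in> carrier G \<Longrightarrow> h \<in> carrier G \<Longrightarrow> w \<in> S \<Longrightarrow>
                 \<psi> (g \<otimes>\<^bsub>G\<^esub> h) w = \<psi> g (\<psi> h w)"
    and one: "\<And>w. w \<in> S \<Longrightarrow> \<psi> \<one>\<^bsub>G\<^esub> w = w"
  shows "group_action G S \<psi>"
proof -
  interpret group G by fact
  have Bij: "\<psi> g \<in> Bij S" if g: "g \<in> carrier G" for g
  proof -
    have "bij_betw (\<psi> g) S S"
    proof (rule bij_betw_byWitness[where f' = "\<psi> (inv\<^bsub>G\<^esub> g)"])
      show "\<forall>a\<in>S. \<psi> (inv\<^bsub>G\<^esub> g) (\<psi> g a) = a"
        using mult[of "inv\<^bsub>G\<^esub> g" g] one g by auto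
      show "\<forall>a\<in>S. \<psi> g (\<psi> (inv\<^bsub>G\<^esub> g) a) = a"
        using mult[of g "inv\<^bsub>G\<^esub> g"] one g by auto
    qed (use closed g in auto)
    then show ?thesis using ext[OF g] by (simp add: Bij_def)
  qed
  have "\<psi> \<in> hom G (BijGroup S)"
  proof (rule homI)
    fix g h assume gh: "g \<in> carrier G" "h \<in> carrier G"
    have "\<psi> (g \<otimes>\<^bsub>G\<^esub> h) = compose S (\<psi> g) (\<psi> h)"
      by (rule extensionalityI[of _ S]) (use mult ext gh in \<open>auto simp: compose_def\<close>)
    then show "\<psi> (g \<otimes>\<^bsub>G\<^esub> h) = \<psi> g \<otimes>\<^bsub>BijGroup S\<^esub> \<psi> h"
      using Bij gh by (simp add: BijGroup_def)
  qed (use Bij in \<open>simp add: BijGroup_def\<close>)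
  then show ?thesis
    by (intro group_action.intro group_hom.intro group_hom_axioms.intro group_BijGroup is_group)
qed

context topological_group
begin

lemma continuous_translations:
  assumes "k \<in> carrier G"
  shows "continuous_map T T (\<lambda>a. k \<otimes> a)" "continuous_map T T (\<lambda>a. a \<otimes> k)"
proof -
  have "continuous_map T (prod_topology T T) (\<lambda>a. (k, a))"
    "continuous_map T (prod_topology T T) (\<lambda>a. (a, k))"
    using assms by (auto intro!: continuous_map_pairedI simp: topspace_eq_carrier)
  from this[THEN continuous_map_compose, OF continuous_mult]
  show "continuous_map T T (\<lambda>a. k \<otimes> a)" "continuous_map T T (\<lambda>a. a \<otimes> k)"
    by (simp_all add: o_def)
qed

end

context length_function
begin

text \<open>
  Lipschitz with respect to the right invariant pseudometric \<open>l (g \<otimes> inv h)\<close>. Right translations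
  preserve this set, and the uniform modulus of continuity is what makes the action jointly
  continuous for pointwise convergence.
\<close>

definition lipschitz_functions :: "('a \<Rightarrow> real) set" where
  "lipschitz_functions =
     {h \<in> carrier G \<rightarrow>\<^sub>E {0..1}. \<forall>u\<in>carrier G. \<forall>g\<in>carrier G. \<bar>h (u \<otimes> g) - h g\<bar> \<le> l u}"

definition lipschitz_topology :: "('a \<Rightarrow> real) topology" where
  "lipschitz_topology =
     subtopology (product_topology (\<lambda>_. euclideanreal) (carrier G)) lipschitz_functions"

definition translate :: "'a \<Rightarrow> ('a \<Rightarrow> real) \<Rightarrow> 'a \<Rightarrow> real" where
  "translate a = (\<lambda>h\<in>lipschitz_functions. \<lambda>g\<in>carrier G. h (g \<otimes> a))"

lemma topspace_lipschitz [simp]: "topspace lipschitz_topology = lipschitz_functions"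
  by (auto simp: lipschitz_topology_def lipschitz_functions_def PiE_def)

lemma continuous_evaluation:
  "g \<in> carrier G \<Longrightarrow> continuous_map lipschitz_topology euclideanreal (\<lambda>h. h g)"
  unfolding lipschitz_topology_def
  by (intro continuous_map_from_subtopology continuous_map_product_projection)

lemma zero_lipschitz: "(\<lambda>g\<in>carrier G. 0) \<in> lipschitz_functions"
  using nonneg by (auto simp: lipschitz_functions_def)

text \<open>
  The Lipschitz condition is a family of closed conditions on finitely many coordinates each, so
  the functions form a closed subset of a cube.
\<close>

lemma compact_lipschitz: "compact_space lipschitz_topology"
proof -
  let ?P = "product_topology (\<lambda>_. euclideanreal) (carrier G)"
  let ?K = "carrier G \<rightarrow>\<^sub>E {0..1::real}"
  have ev: "continuous_map ?P euclideanreal (\<lambda>h. h g)" if "g \<in> carrier G" for g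
    using that by (rule continuous_map_product_projection)
  have K: "compactin ?P ?K" by (simp add: compactin_PiE)
  have K_top: "?K \<subseteq> topspace ?P" by (auto simp: PiE_iff)
  let ?C = "\<lambda>(u, g). {h \<in> topspace ?P. \<bar>h (u \<otimes> g) - h g\<bar> \<in> {..l u}}"
  have C: "closedin ?P (?C z)" if "z \<in> carrier G \<times> carrier G" for z
    unfolding case_prod_unfold using that
    by (intro closedin_continuous_map_preimage[where Y = euclideanreal] continuous_map_real_abs
        continuous_map_diff ev) auto
  have "closedin ?P (\<Inter>z\<in>carrier G \<times> carrier G. ?C z)"
    using C one_closed by (intro closedin_INT) auto
  then have "compactin ?P (?K \<inter> (\<Inter>z\<in>carrier G \<times> carrier G. ?C z))"
    using K by (rule compact_Int_closedin[rotated])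
  moreover have "?K \<inter> (\<Inter>z\<in>carrier G \<times> carrier G. ?C z) = lipschitz_functions"
    using K_top by (auto simp: lipschitz_functions_def)
  ultimately show ?thesis
    by (simp add: lipschitz_topology_def compact_space_subtopology)
qed

lemma translate_lipschitz:
  assumes "a \<in> carrier G" "h \<in> lipschitz_functions"
  shows "translate a h \<in> lipschitz_functions"
  using assms by (auto simp: translate_def lipschitz_functions_def m_assoc PiE_iff)

lemma translate_apply:
  assumes "h \<in> lipschitz_functions" "g \<in> carrier G"
  shows "translate a h g = h (g \<otimes> a)"
  using assms by (simp add: translate_def)

lemma group_action_translate: "group_action G lipschitz_functions translate"
proof (rule group_actionI)
  fix a b h assume *: "a \<in> carrier G" "b \<in> carrier G" "h \<in> lipschitz_functions"
  show "translate (a \<otimes> b) h = translate a (translate b h)"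
  proof (rule extensionalityI)
    show "translate (a \<otimes> b) h x = translate a (translate b h) x" if "x \<in> carrier G" for x
      using that * by (simp add: translate_apply translate_lipschitz m_assoc)
    show "translate (a \<otimes> b) h \<in> extensional (carrier G)"
      "translate a (translate b h) \<in> extensional (carrier G)"
      using * translate_lipschitz by (simp_all add: translate_def)
  qed
next
  fix h assume h: "h \<in> lipschitz_functions"
  show "translate \<one> h = h"
  proof (rule extensionalityI)
    show "translate \<one> h x = h x" if "x \<in> carrier G" for x
      using that h by (simp add: translate_apply)
    show "translate \<one> h \<in> extensional (carrier G)" "h \<in> extensional (carrier G)"
      using h by (auto simp: translate_def lipschitz_functions_def PiE_iff)
  qed
qed (use translate_lipschitz in \<open>simp_all add: translate_def is_group\<close>)

text \<open>
  At a coordinate \<open>k\<close>, moving \<open>a\<close> away from \<open>a0\<close> changes \<open>h (k \<otimes> a)\<close> by at most the length of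
  \<open>k \<otimes> (a \<otimes> inv a0) \<otimes> inv k\<close>, uniformly in \<open>h\<close>; moving \<open>h\<close> at the fixed point \<open>k \<otimes> a0\<close> is
  controlled by pointwise convergence.
\<close>

lemma continuous_translate:
  "continuous_map (prod_topology T lipschitz_topology) lipschitz_topology (\<lambda>(a, h). translate a h)"
proof -
  let ?Q = "prod_topology T lipschitz_topology"
  have "continuous_map ?Q euclideanreal (\<lambda>z. translate (fst z) (snd z) k)"
    if k: "k \<in> carrier G" for k
    unfolding mtopology_is_euclidean[symmetric] Met_TC.continuous_map_to_metric
  proof (intro ballI allI impI)
    fix z and e :: real
    assume z: "z \<in> topspace ?Q" and e: "0 < e"
    obtain a0 h0 where z0: "z = (a0, h0)" by fastforce
    then have a0: "a0 \<in> carrier G" and h0: "h0 \<in> lipschitz_functions"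
      using z by (auto simp: topspace_eq_carrier)
    obtain V where V: "openin T V" "\<one> \<in> V" "\<forall>v\<in>V. l v < e/2"
      using small_near_one[of "e/2"] e by auto
    let ?c = "\<lambda>a. k \<otimes> (a \<otimes> inv a0) \<otimes> inv k"
    let ?A = "{a \<in> topspace T. ?c a \<in> V}"
    let ?B = "{h \<in> topspace lipschitz_topology. h (k \<otimes> a0) \<in> ball (h0 (k \<otimes> a0)) (e/2)}"
    have "continuous_map T T ((\<lambda>a. a \<otimes> inv k) \<circ> (\<lambda>a. k \<otimes> a) \<circ> (\<lambda>a. a \<otimes> inv a0))"
      by (intro continuous_map_compose[of _ T] continuous_translations) (use a0 k in auto)
    then have "continuous_map T T ?c" by (simp add: o_def)
    then have "openin T ?A" using V(1) by (rule openin_continuous_map_preimage)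
    moreover have "openin lipschitz_topology ?B"
      by (rule openin_continuous_map_preimage[OF continuous_evaluation]) (use a0 k in auto)
    ultimately have "openin ?Q (?A \<times> ?B)" by (simp add: openin_prod_Times_iff)
    moreover have "z \<in> ?A \<times> ?B"
      using a0 h0 e k V(2) by (simp add: z0 topspace_eq_carrier)
    moreover have "dist (translate a0 h0 k) (translate a h k) < e" if "a \<in> ?A" "h \<in> ?B" for a h
    proof -
      have a: "a \<in> carrier G" "?c a \<in> V" and h: "h \<in> lipschitz_functions"
        "\<bar>h0 (k \<otimes> a0) - h (k \<otimes> a0)\<bar> < e/2"
        using that by (auto simp: topspace_eq_carrier dist_real_def)
      have "?c a \<otimes> (k \<otimes> a0) = k \<otimes> a" using a(1) a0 k by (simp add: m_assoc inv_solve_left')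
      moreover have "\<bar>h (?c a \<otimes> (k \<otimes> a0)) - h (k \<otimes> a0)\<bar> \<le> l (?c a)"
        using h(1) a(1) a0 k by (simp add: lipschitz_functions_def)
      ultimately have "\<bar>h (k \<otimes> a) - h (k \<otimes> a0)\<bar> < e/2"
        using V(3) a(2) by fastforce
      then have "\<bar>h0 (k \<otimes> a0) - h (k \<otimes> a)\<bar> < e" using h(2) by linarith
      then show ?thesis
        by (simp add: dist_real_def translate_apply[OF h(1) k] translate_apply[OF h0 k])
    qed
    ultimately show "\<exists>U. openin ?Q U \<and> z \<in> U \<and>
        (\<forall>y\<in>U. translate (fst y) (snd y) k \<in> Met_TC.mball (translate (fst z) (snd z) k) e)"
      by (intro exI[of _ "?A \<times> ?B"]) (auto simp: z0)
  qed
  then have "continuous_map ?Q (product_topology (\<lambda>_. euclideanreal) (carrier G))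
      (\<lambda>z. translate (fst z) (snd z))"
    by (auto simp: continuous_map_componentwise translate_def)
  then show ?thesis
    unfolding lipschitz_topology_def[THEN arg_cong, of "\<lambda>X. continuous_map ?Q X _"]
      continuous_map_in_subtopology case_prod_unfold
    using translate_lipschitz by (auto simp: topspace_eq_carrier)
qed

lemma flow_lipschitz: "flow G T lipschitz_topology translate"
proof -
  have "Hausdorff_space lipschitz_topology"
    unfolding lipschitz_topology_def
    by (intro Hausdorff_space_subtopology) (simp add: Hausdorff_space_product_topology)
  then show ?thesis
    using compact_lipschitz group_action_translate continuous_translate zero_lipschitz
    by (auto simp: flow_def)
qed

text \<open>
  The distance to \<open>A\<close>, truncated at \<open>1\<close>; truncation also gives the value \<open>1\<close> when \<open>A\<close> is empty.
\<close>

lemma distance_function_exists: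
  assumes A: "A \<subseteq> carrier G"
  obtains h where "h \<in> lipschitz_functions" "\<And>a. a \<in> A \<Longrightarrow> h a = 0"
    "\<And>g. g \<in> carrier G \<Longrightarrow> h g < 1 \<Longrightarrow> \<exists>a\<in>A. l (g \<otimes> inv a) < 1"
proof -
  define D where "D = (\<lambda>g. insert 1 ((\<lambda>a. l (g \<otimes> inv a)) ` A))"
  define h where "h = (\<lambda>g\<in>carrier G. Inf (D g))"
  have l_one: "l \<one> = 0"
  proof (rule antisym)
    show "l \<one> \<le> 0"
    proof (rule field_le_epsilon)
      fix e :: real assume "0 < e"
      then show "l \<one> \<le> 0 + e" using small_near_one[of e] by force
    qed
  qed (simp add: nonneg)
  have D0: "0 \<le> s" if "g \<in> carrier G" "s \<in> D g" for g s
    using that A nonneg by (auto simp: D_def)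
  have ne: "D g \<noteq> {}" for g by (simp add: D_def)
  have h_le: "h g \<le> s" if "g \<in> carrier G" "s \<in> D g" for g s
    using that D0 by (auto simp: h_def intro!: cInf_lower bdd_belowI[of _ 0])
  have h_greatest: "c \<le> h g" if "g \<in> carrier G" "\<And>s. s \<in> D g \<Longrightarrow> c \<le> s" for c g
    using that ne by (auto simp: h_def intro!: cInf_greatest)
  have step: "h (u \<otimes> g) \<le> l u + h g" if u: "u \<in> carrier G" and g: "g \<in> carrier G" for u g
  proof -
    have "h (u \<otimes> g) - l u \<le> s" if s: "s \<in> D g" for s
    proof (cases "s = 1")
      case True
      have "h (u \<otimes> g) \<le> 1" using u g by (intro h_le) (auto simp: D_def)
      then show ?thesis using True nonneg[OF u] by linarith
    next
      case False
      then obtain a where a: "a \<in> A" "s = l (g \<otimes> inv a)" using s by (auto simp: D_def)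
      then have ac: "a \<in> carrier G" using A by blast
      have "h (u \<otimes> g) \<le> l (u \<otimes> g \<otimes> inv a)" using u g a(1) by (intro h_le) (auto simp: D_def)
      also have "\<dots> \<le> l u + s"
        using subadditive[of u "g \<otimes> inv a"] u g ac a(2) by (simp add: m_assoc)
      finally show ?thesis by simp
    qed
    then have "h (u \<otimes> g) - l u \<le> h g" by (rule h_greatest[OF g])
    then show ?thesis by simp
  qed
  have "\<bar>h (u \<otimes> g) - h g\<bar> \<le> l u" if u: "u \<in> carrier G" and g: "g \<in> carrier G" for u g
  proof -
    have "h g \<le> l u + h (u \<otimes> g)"
      using step[of "inv u" "u \<otimes> g"] u g by (simp add: m_assoc[symmetric] symmetric)
    then show ?thesis using step[OF u g] by linarith
  qed
  moreover have "h g \<in> {0..1}" if "g \<in> carrier G" for g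
    using that h_greatest[OF that D0[OF that]] h_le[OF that, of 1] by (simp add: D_def)
  ultimately have "h \<in> lipschitz_functions" by (auto simp: lipschitz_functions_def h_def)
  moreover have "h a = 0" if "a \<in> A" for a
  proof (rule antisym)
    have a: "a \<in> carrier G" using that A by blast
    have "l (a \<otimes> inv a) \<in> D a" using that unfolding D_def by blast
    then show "h a \<le> 0" using h_le[OF a] a l_one by fastforce
    show "0 \<le> h a" using h_greatest[OF a D0[OF a]] .
  qed
  moreover have "\<exists>a\<in>A. l (g \<otimes> inv a) < 1" if "g \<in> carrier G" "h g < 1" for g
    using that cInf_lessD[OF ne, of g 1] by (auto simp: h_def D_def)
  ultimately show ?thesis by (rule that)
qed

end
section \<open>Almost periodic points\<close>

text \<open>
  Zorn's lemma applied to the open complements of subflows: if the union of a chain of them were the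
  whole space, then by compactness one member would already be, although subflows are nonempty.
\<close>

lemma minimal_subflow_exists:
  assumes X: "compact_space X" and Y: "subflow G X \<phi> Y"
  shows "\<exists>N. subflow G X \<phi> N \<and> N \<subseteq> Y \<and> (\<forall>M. subflow G X \<phi> M \<and> M \<subseteq> N \<longrightarrow> M = N)"
proof -
  define \<A> where "\<A> = {U. U \<subseteq> topspace X \<and> topspace X - Y \<subseteq> U \<and> subflow G X \<phi> (topspace X - U)}"
  have top: "N \<subseteq> topspace X" if "subflow G X \<phi> N" for N
    using that closedin_subset by (auto simp: subflow_def)
  have "topspace X - Y \<in> \<A>"
    using Y top[OF Y] by (auto simp: \<A>_def double_diff)
  then have "\<A> \<noteq> {}" by blast
  moreover have "\<Union>\<C> \<in> \<A>" if ne: "\<C> \<noteq> {}" and chain: "subset.chain \<A> \<C>" for \<C>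
  proof -
    have sub: "\<C> \<subseteq> \<A>" using chain by (simp add: subset_chain_def)
    have op: "openin X U" if "U \<in> \<C>" for U
      using that sub by (auto simp: \<A>_def subflow_def openin_closedin_eq)
    have "topspace X - \<Union>\<C> \<noteq> {}"
    proof
      assume "topspace X - \<Union>\<C> = {}"
      then obtain \<F> where F: "finite \<F>" "\<F> \<subseteq> \<C>" "topspace X \<subseteq> \<Union>\<F>"
        using X op unfolding compact_space_alt by (metis Diff_eq_empty_iff)
      have "topspace X \<noteq> {}" using Y top[OF Y] by (auto simp: subflow_def)
      then have "\<F> \<noteq> {}" using F(3) by auto
      moreover have "subset.chain \<A> \<F>" using chain F(2) by (simp add: subset_chain_def subset_iff)
      ultimately have "\<Union>\<F> \<in> \<F>" using F(1) by (simp add: Union_in_chain)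
      then have "subflow G X \<phi> (topspace X - \<Union>\<F>)" using F(2) sub by (auto simp: \<A>_def)
      then show False using F(3) by (auto simp: subflow_def)
    qed
    moreover have "closedin X (topspace X - \<Union>\<C>)" using op by blast
    moreover have "\<phi> g ` (topspace X - \<Union>\<C>) \<subseteq> topspace X - \<Union>\<C>" if g: "g \<in> carrier G" for g
    proof -
      have "\<phi> g ` (topspace X - U) \<subseteq> topspace X - U" if "U \<in> \<C>" for U
        using that sub g by (auto simp: \<A>_def subflow_def)
      then show ?thesis using ne by (fastforce simp: image_subset_iff)
    qed
    ultimately have "subflow G X \<phi> (topspace X - \<Union>\<C>)" by (simp add: subflow_def)
    moreover have "\<Union>\<C> \<subseteq> topspace X" "topspace X - Y \<subseteq> \<Union>\<C>"
      using sub ne by (auto simp: \<A>_def)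
    ultimately show ?thesis by (simp add: \<A>_def)
  qed
  ultimately obtain U where U: "U \<in> \<A>" "\<And>V. V \<in> \<A> \<Longrightarrow> U \<subseteq> V \<Longrightarrow> V = U"
    using subset_Zorn_nonempty[of \<A>] by metis
  have "M = topspace X - U" if M: "subflow G X \<phi> M" "M \<subseteq> topspace X - U" for M
  proof -
    have "topspace X - M \<in> \<A>"
      using M U(1) top[OF M(1)] by (auto simp: \<A>_def double_diff)
    moreover have "U \<subseteq> topspace X - M" using M(2) U(1) by (auto simp: \<A>_def)
    ultimately have "topspace X - M = U" by (rule U(2))
    then show ?thesis using top[OF M(1)] by auto
  qed
  moreover have "subflow G X \<phi> (topspace X - U)" "topspace X - U \<subseteq> Y"
    using U(1) by (auto simp: \<A>_def)
  ultimately show ?thesis by blast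
qed

lemma orbit_closure_subset:
  assumes "subflow G X \<phi> Y" "x \<in> Y"
  shows "X closure_of orbit G \<phi> x \<subseteq> Y"
  using assms by (intro closure_of_minimal) (auto simp: subflow_def orbit_def)

lemma flow_mem_orbit_closure:
  assumes "flow G T X \<phi>" "x \<in> topspace X"
  shows "x \<in> X closure_of orbit G \<phi> x"
proof -
  interpret group_action G "topspace X" \<phi> using assms by (simp add: flow_def)
  have "orbit G \<phi> x \<subseteq> topspace X" using assms(2) element_image by (auto simp: orbit_def)
  then show ?thesis using orbit_refl[OF assms(2)] closure_of_subset by blast
qed

lemma subflow_orbit_closure:
  assumes "topological_group G T" "flow G T X \<phi>" "x \<in> topspace X"
  shows "subflow G X \<phi> (X closure_of orbit G \<phi> x)"
  using orbit_closure_invariant[OF assms] flow_mem_orbit_closure[OF assms(2,3)]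
  by (auto simp: subflow_def)

text \<open>
  Take a minimal closed invariant subset \<open>N\<close> of the part of \<open>W\<close> above the orbit closure of \<open>x\<close>. Its
  projection to \<open>X\<close> is a subflow of a minimal flow, so contains \<open>x\<close>; this gives \<open>z'\<close>. A subflow
  \<open>Y\<close> of the orbit closure of \<open>z'\<close> meets the projection of \<open>N\<close> to \<open>Z\<close>, so by minimality all of \<open>N\<close>
  lies above \<open>Y\<close>, and in particular \<open>z'\<close> is in \<open>Y\<close>.
\<close>

lemma AP_lifts_to_joining:
  assumes TG: "topological_group G T" and FX: "flow G T X \<phi>" and FZ: "flow G T Z \<theta>"
    and W: "subflow G (prod_topology X Z) (\<lambda>g (x, z). (\<phi> g x, \<theta> g z)) W"
    and x: "x \<in> AP G X \<phi>" and xz: "(x, z) \<in> W"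
  obtains z' where "z' \<in> AP G Z \<theta>" "(x, z') \<in> W"
proof -
  let ?P = "prod_topology X Z"
  let ?\<Phi> = "\<lambda>g (x, z). (\<phi> g x, \<theta> g z)"
  let ?C = "X closure_of orbit G \<phi> x"
  have xX: "x \<in> topspace X" using x by (simp add: AP_def)
  have C: "subflow G X \<phi> ?C" by (rule subflow_orbit_closure[OF TG FX xX])
  then have clC: "closedin X ?C" and invC: "\<forall>g\<in>carrier G. \<phi> g ` ?C \<subseteq> ?C"
    by (simp_all add: subflow_def)
  have cX: "compact_space X" and cZ: "compact_space Z"
    using FX FZ by (simp_all add: flow_def)
  have cP: "compact_space ?P" using cX cZ by (simp add: compact_space_prod_topology)
  have invX: "\<forall>g\<in>carrier G. \<phi> g ` topspace X \<subseteq> topspace X"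
    using FX group_action.element_image[of G "topspace X" \<phi>] by (auto simp: flow_def)
  have invZ: "\<forall>g\<in>carrier G. \<theta> g ` topspace Z \<subseteq> topspace Z"
    using FZ group_action.element_image[of G "topspace Z" \<theta>] by (auto simp: flow_def)
  have W_sub: "W \<subseteq> topspace ?P" using W closedin_subset[of ?P W] unfolding subflow_def by blast
  have prod_subflow: "subflow G ?P ?\<Phi> (M \<inter> A \<times> B)"
    if M: "subflow G ?P ?\<Phi> M" and A: "closedin X A" "\<forall>g\<in>carrier G. \<phi> g ` A \<subseteq> A"
      and B: "closedin Z B" "\<forall>g\<in>carrier G. \<theta> g ` B \<subseteq> B" and ne: "M \<inter> A \<times> B \<noteq> {}" for M A B
  proof -
    have "closedin ?P (M \<inter> A \<times> B)"
      using M A(1) B(1) by (auto simp: subflow_def closedin_prod_Times_iff)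
    moreover have "?\<Phi> g ` (M \<inter> A \<times> B) \<subseteq> M \<inter> A \<times> B" if "g \<in> carrier G" for g
    proof clarify
      fix a b assume "(a, b) \<in> M" "a \<in> A" "b \<in> B"
      moreover from this(1) have "(\<phi> g a, \<theta> g b) \<in> M"
        using M that unfolding subflow_def by fastforce
      ultimately show "(\<phi> g a, \<theta> g b) \<in> M \<inter> A \<times> B" using A(2) B(2) that by blast
    qed
    ultimately show ?thesis using ne by (simp add: subflow_def)
  qed
  have "x \<in> ?C" by (rule flow_mem_orbit_closure[OF FX xX])
  then have "W \<inter> ?C \<times> topspace Z \<noteq> {}" using xz W_sub by auto
  then have "subflow G ?P ?\<Phi> (W \<inter> ?C \<times> topspace Z)"
    by (rule prod_subflow[OF W clC invC closedin_topspace invZ])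
  from minimal_subflow_exists[OF cP this] obtain N where
    N: "subflow G ?P ?\<Phi> N" "N \<subseteq> W \<inter> ?C \<times> topspace Z"
    and min: "\<forall>M. subflow G ?P ?\<Phi> M \<and> M \<subseteq> N \<longrightarrow> M = N"
    by (elim exE conjE)
  have "closed_map ?P X fst" "closed_map ?P Z snd"
    using cX cZ by (simp_all add: closed_map_fst closed_map_snd)
  then have cl: "closedin X (fst ` N)" "closedin Z (snd ` N)"
    using N(1) by (auto simp: closed_map_def subflow_def)
  have inv: "(\<phi> g y, \<theta> g w) \<in> N" if "(y, w) \<in> N" "g \<in> carrier G" for g y w
    using N(1) that by (fastforce simp: subflow_def)
  have "subflow G X \<phi> (fst ` N)"
    unfolding subflow_def
  proof (intro conjI ballI)
    show "fst ` N \<noteq> {}" using N(1) by (simp add: subflow_def)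
    show "\<phi> g ` fst ` N \<subseteq> fst ` N" if "g \<in> carrier G" for g using inv that by force
  qed (rule cl)
  moreover have "fst ` N \<subseteq> ?C" using N(2) by auto
  ultimately have "x \<in> fst ` N" using x AP_iff[OF TG FX] by blast
  then obtain z' where z': "(x, z') \<in> N" by auto
  then have z'Z: "z' \<in> topspace Z" using N(2) by auto
  have sub_snd: "subflow G Z \<theta> (snd ` N)"
    unfolding subflow_def
  proof (intro conjI ballI)
    show "snd ` N \<noteq> {}" using N(1) by (simp add: subflow_def)
    show "\<theta> g ` snd ` N \<subseteq> snd ` N" if "g \<in> carrier G" for g using inv that by force
  qed (rule cl)
  have "z' \<in> snd ` N" using z' by force
  with sub_snd have orb: "Z closure_of orbit G \<theta> z' \<subseteq> snd ` N" by (rule orbit_closure_subset)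
  have "z' \<in> Y" if Y: "subflow G Z \<theta> Y" "Y \<subseteq> Z closure_of orbit G \<theta> z'" for Y
  proof -
    obtain w where "w \<in> Y" using Y(1) by (auto simp: subflow_def)
    then obtain y where "(y, w) \<in> N" using Y(2) orb by force
    then have "N \<inter> topspace X \<times> Y \<noteq> {}" using \<open>w \<in> Y\<close> N(2) W_sub by auto
    moreover have "closedin Z Y" "\<forall>g\<in>carrier G. \<theta> g ` Y \<subseteq> Y"
      using Y(1) by (simp_all add: subflow_def)
    ultimately have "subflow G ?P ?\<Phi> (N \<inter> topspace X \<times> Y)"
      by (intro prod_subflow[OF N(1) closedin_topspace invX])
    then have "N \<inter> topspace X \<times> Y = N" by (intro min[rule_format] conjI) auto
    then show ?thesis using z' by auto
  qed
  then have "z' \<in> AP G Z \<theta>" using AP_iff[OF TG FZ] z'Z by blast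
  then show ?thesis using that z' N(2) by blast
qed

text \<open>
  The inequality holds on an open subset of \<open>G \<times> X\<close> that contains the slice over the identity, so
  the tube lemma applies.
\<close>

lemma flow_uniformly_continuous:
  assumes TG: "topological_group G T" and FX: "flow G T X \<phi>"
    and f: "continuous_map X euclideanreal f" and e: "(0::real) < e"
  obtains U where "openin T U" "\<one>\<^bsub>G\<^esub> \<in> U"
    "\<And>u z. u \<in> U \<Longrightarrow> z \<in> topspace X \<Longrightarrow> \<bar>f (\<phi> u z) - f z\<bar> < e"
proof -
  interpret TG: topological_group G T by fact
  interpret act: group_action G "topspace X" \<phi> using FX by (simp add: flow_def)
  let ?P = "prod_topology T X"
  let ?D = "\<lambda>z. f (case z of (g, x) \<Rightarrow> \<phi> g x) - f (snd z)"
  have "continuous_map ?P X (\<lambda>(g, x). \<phi> g x)" using FX by (simp add: flow_def)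
  then have "continuous_map ?P euclideanreal (\<lambda>z. f (case z of (g, x) \<Rightarrow> \<phi> g x))"
    "continuous_map ?P euclideanreal (\<lambda>z. f (snd z))"
    using continuous_map_compose[OF _ f] continuous_map_snd by (auto simp: o_def)
  then have "continuous_map ?P euclideanreal ?D" by (rule continuous_map_diff)
  then have op: "openin ?P {z \<in> topspace ?P. ?D z \<in> {-e<..<e}}"
    by (rule openin_continuous_map_preimage) simp
  have "\<phi> \<one>\<^bsub>G\<^esub> z = z" if "z \<in> topspace X" for z
    using act.id_eq_one that by (metis restrict_apply')
  then have sub: "{\<one>\<^bsub>G\<^esub>} \<times> topspace X \<subseteq> {z \<in> topspace ?P. ?D z \<in> {-e<..<e}}"
    using e by (auto simp: TG.topspace_eq_carrier)
  have c: "compactin X (topspace X)" using FX by (simp add: flow_def compact_space_def)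
  have o: "\<one>\<^bsub>G\<^esub> \<in> topspace T" by (simp add: TG.topspace_eq_carrier)
  obtain U V where UV: "openin T U" "\<one>\<^bsub>G\<^esub> \<in> U" "topspace X \<subseteq> V"
    "U \<times> V \<subseteq> {z \<in> topspace ?P. ?D z \<in> {-e<..<e}}"
    using tube_lemma_right[OF op c o sub] by (elim exE conjE) (rule that)
  have "\<bar>f (\<phi> u z) - f z\<bar> < e" if "u \<in> U" "z \<in> topspace X" for u z
  proof -
    have "?D (u, z) \<in> {-e<..<e}" using UV(3) subsetD[OF UV(4), of "(u, z)"] that by auto
    then show ?thesis by (simp add: abs_less_iff)
  qed
  then show ?thesis by (rule that[OF UV(1,2)])
qed

lemma flow_pullback:
  assumes TG: "topological_group G T" and FZ: "flow H S Z \<psi>"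
    and p: "p \<in> hom G H" "continuous_map T S p"
  shows "flow G T Z (\<lambda>g. \<psi> (p g))"
proof -
  interpret TG: topological_group G T by fact
  have "group_action H (topspace Z) \<psi>" using FZ by (simp add: flow_def)
  then have "\<psi> \<in> hom H (BijGroup (topspace Z))"
    by (simp add: group_action_def group_hom_def group_hom_axioms_def)
  then have "\<psi> \<circ> p \<in> hom G (BijGroup (topspace Z))" using p(1) hom_compose by blast
  then have act: "group_action G (topspace Z) (\<lambda>g. \<psi> (p g))"
    unfolding o_def
    by (intro group_action.intro group_hom.intro group_hom_axioms.intro group_BijGroup TG.is_group)
  have "continuous_map (prod_topology T Z) (prod_topology S Z) (\<lambda>(g, z). (p g, id z))"
    unfolding continuous_map_prod_top using p(2) by simp
  moreover have "continuous_map (prod_topology S Z) Z (\<lambda>(g, z). \<psi> g z)"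
    using FZ by (simp add: flow_def)
  ultimately have "continuous_map (prod_topology T Z) Z (\<lambda>(g, z). \<psi> (p g) z)"
    using continuous_map_compose by (fastforce simp: o_def case_prod_unfold)
  then show ?thesis using FZ act by (simp add: flow_def)
qed

lemma AP_pullback:
  fixes Z :: "'z topology"
  assumes "p ` carrier G = carrier H"
  shows "AP G Z (\<lambda>g. \<psi> (p g)) = AP H Z \<psi>"
proof -
  have "orbit G (\<lambda>g. \<psi> (p g)) z = orbit H \<psi> z" for z
    unfolding orbit_def assms[symmetric] by blast
  moreover have "subflow G Y (\<lambda>g. \<psi> (p g)) = subflow H Y \<psi>" for Y :: "'z topology"
    unfolding subflow_def assms[symmetric] by (simp add: fun_eq_iff)
  ultimately show ?thesis by (simp add: AP_def minimal_flow_def)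
qed




section \<open>Groups approximated by groups with closed sets of almost periodic points\<close>

text \<open>
  The topology of \<open>H\<close> can be coarser than that of the quotient of \<open>G\<close> by the kernel of \<open>p\<close>, so a
  function on \<open>H\<close> derived from an orbit function of \<open>X\<close> may fail to be continuous. For this reason
  the functions on \<open>H\<close> are made from a length function of \<open>H\<close> itself, and are tied to \<open>X\<close> only by
  the relation \<open>W\<close>.
\<close>

theorem CAP_if_approximated_by_CAP_groups:
  fixes G :: "('a, 'm) monoid_scheme"
  assumes TG: "topological_group G T"
    and approx: "\<And>U. openin T U \<Longrightarrow> \<one>\<^bsub>G\<^esub> \<in> U \<Longrightarrow>
      \<exists>(H :: ('b, 'n) monoid_scheme) S p V. topological_group H S \<and> CAP TYPE('b \<Rightarrow> real) H S \<and>
        p \<in> hom G H \<and> continuous_map T S p \<and> p ` carrier G = carrier H \<and>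
        openin S V \<and> \<one>\<^bsub>H\<^esub> \<in> V \<and> (\<forall>g\<in>carrier G. p g \<in> V \<longrightarrow> g \<in> U)"
  shows "CAP TYPE('x) G T"
  unfolding CAP_def
proof (intro allI impI)
  fix X :: "'x topology" and \<phi> assume FX: "flow G T X \<phi>"
  interpret TG: topological_group G T by fact
  interpret act: group_action G "topspace X" \<phi> using FX by (simp add: flow_def)
  have cX: "compact_space X" and HX: "Hausdorff_space X" using FX by (auto simp: flow_def)
  have APsub: "AP G X \<phi> \<subseteq> topspace X" by (auto simp: AP_def)
  have "x \<in> AP G X \<phi>" if x: "x \<in> X closure_of AP G X \<phi>" for x
  proof -
    have xX: "x \<in> topspace X" using x closure_of_subset_topspace by fastforce
    have "x \<in> Y" if Y: "subflow G X \<phi> Y" "Y \<subseteq> X closure_of orbit G \<phi> x" for Y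
    proof (rule ccontr)
      assume nx: "x \<notin> Y"
      have n: "normal_space X"
        using cX HX by (simp add: compact_Hausdorff_or_regular_imp_normal_space)
      have YX: "Y \<subseteq> topspace X" using Y(1) closedin_subset by (auto simp: subflow_def)
      have "closedin X {x}" using HX xX by (simp add: closedin_Hausdorff_singleton)
      moreover have "closedin X Y" "disjnt Y {x}"
        using Y nx by (auto simp: subflow_def disjnt_def)
      ultimately obtain f where f: "continuous_map X euclideanreal f" "f ` Y \<subseteq> {0::real}" "f ` {x} \<subseteq> {1}"
        using Urysohn_lemma_alt[OF n] by metis
      obtain U where U: "openin T U" "\<one>\<^bsub>G\<^esub> \<in> U"
        "\<And>u z. u \<in> U \<Longrightarrow> z \<in> topspace X \<Longrightarrow> \<bar>f (\<phi> u z) - f z\<bar> < 1/3"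
        using flow_uniformly_continuous[OF TG FX f(1), of "1/3"] by auto
      obtain H :: "('b, 'n) monoid_scheme" and S p V where TH: "topological_group H S"
        and cap: "CAP TYPE('b \<Rightarrow> real) H S" and p: "p \<in> hom G H" "continuous_map T S p"
        and surj: "p ` carrier G = carrier H"
        and V: "openin S V" "\<one>\<^bsub>H\<^esub> \<in> V" "\<forall>g\<in>carrier G. p g \<in> V \<longrightarrow> g \<in> U"
        using approx[OF U(1,2)] by blast
      interpret TH: topological_group H S by fact
      interpret p: group_hom G H p
        using p(1) by (simp add: group_hom_def group_hom_axioms_def TG.is_group TH.is_group)
      obtain l where lf: "length_function H S l"
        and l: "\<And>g. g \<in> carrier H \<Longrightarrow> l g < 1 \<Longrightarrow> g \<in> V"
        using TH.length_function_exists[OF V(1,2)] by blast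
      interpret L: length_function H S l by fact
      let ?Z = L.lipschitz_topology and ?L = L.lipschitz_functions
      define \<theta> where "\<theta> = (\<lambda>g. L.translate (p g))"
      have FZ: "flow G T ?Z \<theta>"
        unfolding \<theta>_def using TG L.flow_lipschitz p by (rule flow_pullback)
      have "AP G ?Z \<theta> = AP H ?Z L.translate"
        unfolding \<theta>_def using surj by (rule AP_pullback)
      then have clAP: "closedin ?Z (AP G ?Z \<theta>)"
        using cap L.flow_lipschitz by (simp add: CAP_def)
      have cZ: "compact_space ?Z" using FZ by (simp add: flow_def)
      have \<theta>_L: "\<theta> g h \<in> ?L" if "g \<in> carrier G" "h \<in> ?L" for g h
        using that L.translate_lipschitz by (simp add: \<theta>_def)
      have \<theta>_apply: "\<theta> a h (p g) = h (p (g \<otimes>\<^bsub>G\<^esub> a))"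
        if "h \<in> ?L" "g \<in> carrier G" "a \<in> carrier G" for a g h
        using that L.translate_apply by (simp add: \<theta>_def)
      let ?P = "prod_topology X ?Z"
      \<comment> \<open>In \<open>(y, h) \<in> W\<close> the function \<open>h\<close> is a coarse shadow of \<open>g \<mapsto> f (\<phi> g y)\<close>: it is
          prescribed where this orbit function is below \<open>1/3\<close> or above \<open>2/3\<close>. The gap of \<open>1/3\<close> is the
          tolerance of \<open>U\<close>. Each implication is written as a disjunction of closed conditions.\<close>
      let ?R = "\<lambda>g. {z \<in> topspace ?P. f (\<phi> g (fst z)) \<in> {1/3..} \<or> snd z (p g) \<in> {0}} \<inter>
                     {z \<in> topspace ?P. f (\<phi> g (fst z)) \<in> {..2/3} \<or> snd z (p g) \<in> {1}}"
      define W where "W = (\<Inter>g\<in>carrier G. ?R g)"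
      have W_iff: "(y, h) \<in> W \<longleftrightarrow> y \<in> topspace X \<and> h \<in> ?L \<and>
          (\<forall>g\<in>carrier G. (f (\<phi> g y) < 1/3 \<longrightarrow> h (p g) = 0) \<and> (f (\<phi> g y) > 2/3 \<longrightarrow> h (p g) = 1))" for y h
        unfolding W_def using TG.one_closed by (auto simp: not_less)
      have W_total: "\<exists>h. (y, h) \<in> W" if y: "y \<in> topspace X" for y
      proof -
        \<comment> \<open>Two elements \<open>a\<close>, \<open>g\<close> of \<open>G\<close> with orbit values below \<open>1/3\<close> and above \<open>2/3\<close> cannot have
            images at distance less than \<open>1\<close>, as then \<open>g \<otimes> inv a\<close> would be in \<open>U\<close>.\<close>
        let ?A = "p ` {a \<in> carrier G. f (\<phi> a y) < 1/3}"
        have "?A \<subseteq> carrier H" by auto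
        then obtain h where h: "h \<in> ?L" "\<And>a. a \<in> ?A \<Longrightarrow> h a = 0"
          "\<And>g. g \<in> carrier H \<Longrightarrow> h g < 1 \<Longrightarrow> \<exists>a\<in>?A. l (g \<otimes>\<^bsub>H\<^esub> inv\<^bsub>H\<^esub> a) < 1"
          by (rule L.distance_function_exists) blast
        have "h (p g) = 1" if g: "g \<in> carrier G" "f (\<phi> g y) > 2/3" for g
        proof (rule ccontr)
          assume "h (p g) \<noteq> 1"
          moreover have "h (p g) \<le> 1" using h(1) g(1) by (auto simp: L.lipschitz_functions_def PiE_iff)
          ultimately have "h (p g) < 1" by simp
          then obtain a where a: "a \<in> carrier G" "f (\<phi> a y) < 1/3" "l (p g \<otimes>\<^bsub>H\<^esub> inv\<^bsub>H\<^esub> p a) < 1"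
            using h(3)[of "p g"] g(1) by auto
          let ?u = "g \<otimes>\<^bsub>G\<^esub> inv\<^bsub>G\<^esub> a"
          have "p ?u = p g \<otimes>\<^bsub>H\<^esub> inv\<^bsub>H\<^esub> p a" using g(1) a(1) by simp
          then have "p ?u \<in> V" using l a g(1) by simp
          then have "?u \<in> U" using V(3) g(1) a(1) by simp
          moreover have "\<phi> a y \<in> topspace X" using act.element_image[OF a(1) y] by simp
          ultimately have "\<bar>f (\<phi> ?u (\<phi> a y)) - f (\<phi> a y)\<bar> < 1/3" by (rule U(3))
          moreover have "\<phi> ?u (\<phi> a y) = \<phi> g y"
            using act.composition_rule[OF y, of ?u a] g(1) a(1) by (simp add: TG.m_assoc)
          ultimately show False using a(2) g(2) by simp
        qed
        then have "(y, h) \<in> W" using h(1,2) y by (auto simp: W_iff)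
        then show ?thesis by blast
      qed
      have W: "subflow G ?P (\<lambda>g (y, h). (\<phi> g y, \<theta> g h)) W"
        unfolding subflow_def
      proof (intro conjI ballI)
        show "W \<noteq> {}" using W_total[OF xX] by auto
        have "closedin ?P (?R g)" if g: "g \<in> carrier G" for g
        proof -
          have "continuous_map ?P euclideanreal (f \<circ> \<phi> g \<circ> fst)"
            using continuous_map_fst flow_action_continuous[OF TG FX g] f(1)
            by (intro continuous_map_compose)
          then have 1: "continuous_map ?P euclideanreal (\<lambda>z. f (\<phi> g (fst z)))" by (simp add: o_def)
          have "continuous_map ?P euclideanreal ((\<lambda>h. h (p g)) \<circ> snd)"
            using g by (intro continuous_map_compose[OF continuous_map_snd] L.continuous_evaluation) simp
          then have 2: "continuous_map ?P euclideanreal (\<lambda>z. snd z (p g))" by (simp add: o_def)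
          show ?thesis
            unfolding Collect_conj_eq Collect_disj_eq conj_disj_distribL
            by (intro closedin_Int closedin_Un closedin_continuous_map_preimage[OF 1, simplified Collect_conj_eq]
                closedin_continuous_map_preimage[OF 2, simplified Collect_conj_eq]) auto
        qed
        then show "closedin ?P W" unfolding W_def using TG.one_closed by (intro closedin_INT) auto
        fix a assume a: "a \<in> carrier G"
        have "(\<phi> a y, \<theta> a h) \<in> W" if yh: "(y, h) \<in> W" for y h
        proof -
          have y: "y \<in> topspace X" and h: "h \<in> ?L" using yh by (auto simp: W_iff)
          have "(f (\<phi> g (\<phi> a y)) < 1/3 \<longrightarrow> \<theta> a h (p g) = 0) \<and>
              (f (\<phi> g (\<phi> a y)) > 2/3 \<longrightarrow> \<theta> a h (p g) = 1)" if g: "g \<in> carrier G" for g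
          proof -
            have "g \<otimes>\<^bsub>G\<^esub> a \<in> carrier G" using g a by simp
            then show ?thesis
              unfolding \<theta>_apply[OF h g a] act.composition_rule[OF y g a, symmetric]
              using yh unfolding W_iff by blast
          qed
          moreover have "\<phi> a y \<in> topspace X" using act.element_image[OF a y] by simp
          ultimately show ?thesis using \<theta>_L[OF a h] by (simp only: W_iff) blast
        qed
        then show "(\<lambda>(y, h). (\<phi> a y, \<theta> a h)) ` W \<subseteq> W" by auto
      qed
      have proj_closed: "closedin X (fst ` (W \<inter> topspace X \<times> B))" if "closedin ?Z B" for B
      proof -
        have "closedin ?P (W \<inter> topspace X \<times> B)"
          using W that by (auto simp: subflow_def closedin_prod_Times_iff)
        then show ?thesis using closed_map_fst[OF cZ] by (auto simp: closed_map_def)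
      qed
      have "AP G X \<phi> \<subseteq> fst ` (W \<inter> topspace X \<times> AP G ?Z \<theta>)"
      proof
        fix y assume y: "y \<in> AP G X \<phi>"
        then have yX: "y \<in> topspace X" using APsub by blast
        then obtain h0 where "(y, h0) \<in> W" using W_total by blast
        then obtain h where "h \<in> AP G ?Z \<theta>" "(y, h) \<in> W"
          using AP_lifts_to_joining[OF TG FX FZ W y] by blast
        then show "y \<in> fst ` (W \<inter> topspace X \<times> AP G ?Z \<theta>)" using yX by force
      qed
      then have "x \<in> fst ` (W \<inter> topspace X \<times> AP G ?Z \<theta>)"
        using x closure_of_minimal[OF _ proj_closed[OF clAP]] by blast
      then obtain h where hAP: "h \<in> AP G ?Z \<theta>" and xh: "(x, h) \<in> W" by auto
      let ?C = "?Z closure_of orbit G \<theta> h"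
      have hL: "h \<in> topspace ?Z" using xh by (simp add: W_iff)
      have C: "subflow G ?Z \<theta> ?C" by (rule subflow_orbit_closure[OF TG FZ hL])
      \<comment> \<open>The points with a partner in the orbit closure of \<open>h\<close> form a subflow containing \<open>x\<close>, hence
          all of its orbit closure and in particular \<open>Y\<close>.\<close>
      let ?D = "fst ` (W \<inter> topspace X \<times> ?C)"
      have xD: "x \<in> ?D" using xh xX flow_mem_orbit_closure[OF FZ hL] by force
      have "\<phi> g y \<in> ?D" if g: "g \<in> carrier G" and y: "y \<in> ?D" for g y
      proof -
        obtain k where k: "(y, k) \<in> W" "k \<in> ?C" using y by auto
        have "(\<phi> g y, \<theta> g k) \<in> W"
          using W k(1) g unfolding subflow_def by fastforce
        moreover have "\<theta> g k \<in> ?C" using C k(2) g unfolding subflow_def by blast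
        moreover have "\<phi> g y \<in> topspace X" using calculation(1) unfolding W_iff by blast
        ultimately have "(\<phi> g y, \<theta> g k) \<in> W \<inter> topspace X \<times> ?C" by blast
        then show ?thesis by (rule image_eqI[rotated]) simp
      qed
      then have "\<forall>g\<in>carrier G. \<phi> g ` ?D \<subseteq> ?D" by (intro ballI image_subsetI)
      moreover have "?D \<noteq> {}" using xD by (metis empty_iff)
      moreover have "closedin X ?D" by (rule proj_closed) (rule closedin_closure_of)
      ultimately have "subflow G X \<phi> ?D" unfolding subflow_def by (intro conjI)
      then have "Y \<subseteq> ?D" by (rule order_trans[OF Y(2) orbit_closure_subset, OF _ xD])
      moreover obtain y where y: "y \<in> Y" using Y(1) by (auto simp: subflow_def)
      ultimately have "y \<in> ?D" by blast
      then obtain k where yk: "(y, k) \<in> W" and k: "k \<in> ?C" by auto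
      let ?zero = "\<lambda>g\<in>carrier H. 0 :: real"
      have kL: "k \<in> ?L" using yk by (simp add: W_iff)
      have "k (p g) = 0" if g: "g \<in> carrier G" for g
      proof -
        have "\<phi> g y \<in> Y" using Y(1) y g by (auto simp: subflow_def)
        then have "f (\<phi> g y) = 0" using f(2) by auto
        then show ?thesis using yk g by (simp add: W_iff)
      qed
      then have "k g = 0" if "g \<in> carrier H" for g
        using that unfolding surj[symmetric] by blast
      then have k0: "k = ?zero"
        using kL by (intro extensionalityI[of _ "carrier H"]) (auto simp: L.lipschitz_functions_def PiE_iff)
      have "\<theta> g ?zero = ?zero" if "g \<in> carrier G" for g
        using that L.zero_lipschitz by (auto simp: \<theta>_def L.translate_def)
      moreover have "closedin ?Z {?zero}"
        using FZ L.zero_lipschitz by (simp add: flow_def closedin_Hausdorff_singleton)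
      ultimately have "subflow G ?Z \<theta> {?zero}" by (simp add: subflow_def)
      moreover have "{?zero} \<subseteq> ?C" using k k0 by simp
      ultimately have "h \<in> {?zero}" using hAP AP_iff[OF TG FZ] by blast
      moreover have "\<phi> \<one>\<^bsub>G\<^esub> x = x" using act.id_eq_one xX by (metis restrict_apply')
      then have "f (\<phi> \<one>\<^bsub>G\<^esub> x) > 2/3" using f(3) by simp
      then have "h (p \<one>\<^bsub>G\<^esub>) = 1" using xh TG.one_closed unfolding W_iff by blast
      ultimately show False using TG.one_closed by simp
    qed
    then show ?thesis using AP_iff[OF TG FX] xX by blast
  qed
  then show "closedin X (AP G X \<phi>)"
    using APsub closure_of_subset_eq by blast
qed

section \<open>Inverse limits\<close>

lemma (in inverse_system) finite_index_bound:
  "finite F \<Longrightarrow> F \<subseteq> I \<Longrightarrow> \<exists>k\<in>I. \<forall>i\<in>F. (i, k) \<in> r"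
proof (induction rule: finite_induct)
  case empty
  then show ?case using index_nonempty by auto
next
  case (insert i F)
  then obtain k where k: "k \<in> I" "\<forall>i\<in>F. (i, k) \<in> r" by auto
  then obtain m where "m \<in> I" "(i, m) \<in> r" "(k, m) \<in> r" using index_directed insert.prems by blast
  moreover from this(3) have "\<forall>j\<in>F. (j, m) \<in> r"
    using k(2) index_preorder unfolding preorder_on_def by (meson transD)
  ultimately show ?case by blast
qed

text \<open>
  A basic neighbourhood restricts finitely many coordinates; an upper bound \<open>k\<close> of their indices
  determines all of them continuously.
\<close>

lemma (in inverse_system) inverse_limit_neighbourhood_of_one:
  assumes U: "openin (inverse_limit_topology I r G T \<pi>) U" "\<one>\<^bsub>inverse_limit I r G \<pi>\<^esub> \<in> U"
  obtains k V where "k \<in> I" "openin (T k) V" "\<one>\<^bsub>G k\<^esub> \<in> V"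
    "\<And>g. g \<in> carrier (inverse_limit I r G \<pi>) \<Longrightarrow> g k \<in> V \<Longrightarrow> g \<in> U"
proof -
  let ?L = "inverse_limit I r G \<pi>"
  have idx: "i \<in> I" "j \<in> I" if "(i, j) \<in> r" for i j
    using index_preorder that by (auto simp: preorder_on_def)
  have top: "topspace (T i) = carrier (G i)" if "i \<in> I" for i
    using topological_group.topspace_eq_carrier[OF groups[OF that]] .
  have grp: "group (G i)" if "i \<in> I" for i
    using groups[OF that] by (simp add: topological_group_def)
  obtain Q where Q: "openin (product_topology T I) Q" "U = Q \<inter> carrier ?L"
    using U(1) by (auto simp: inverse_limit_topology_def openin_subtopology)
  have one_Q: "\<one>\<^bsub>?L\<^esub> \<in> Q" using U(2) Q(2) by blast
  obtain B where B: "finite {i \<in> I. B i \<noteq> topspace (T i)}" "\<And>i. i \<in> I \<Longrightarrow> openin (T i) (B i)"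
    "\<one>\<^bsub>?L\<^esub> \<in> Pi\<^sub>E I B" "Pi\<^sub>E I B \<subseteq> Q"
    using Q(1)[unfolded openin_product_topology_alt, rule_format, OF one_Q]
    by (elim exE conjE) (rule that, simp_all)
  let ?F = "{i \<in> I. B i \<noteq> topspace (T i)}"
  obtain k where k: "k \<in> I" "\<forall>i\<in>?F. (i, k) \<in> r" using finite_index_bound[OF B(1)] by auto
  define V where "V = (\<Inter>i\<in>?F. {x \<in> topspace (T k). \<pi> i k x \<in> B i}) \<inter> topspace (T k)"
  have "openin (T k) V"
    unfolding V_def using B(1) k B(2)
    by (intro openin_INT openin_continuous_map_preimage[OF bonding_continuous]) auto
  moreover have "\<one>\<^bsub>G k\<^esub> \<in> V"
  proof -
    have "\<pi> i k \<one>\<^bsub>G k\<^esub> \<in> B i" if i: "i \<in> ?F" for i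
    proof -
      have "\<pi> i k \<one>\<^bsub>G k\<^esub> = \<one>\<^bsub>G i\<^esub>"
        using i k bonding_hom grp by (intro hom_one) auto
      moreover have "\<one>\<^bsub>?L\<^esub> i \<in> B i" using B(3) i by auto
      ultimately show ?thesis using i by (simp add: inverse_limit_def)
    qed
    moreover have "\<one>\<^bsub>G k\<^esub> \<in> topspace (T k)"
      using top[OF k(1)] monoid.one_closed[OF group.is_monoid[OF grp[OF k(1)]]] by simp
    ultimately show ?thesis by (simp add: V_def)
  qed
  moreover have "g \<in> U" if g: "g \<in> carrier ?L" "g k \<in> V" for g
  proof -
    have gc: "g \<in> (\<Pi>\<^sub>E i\<in>I. carrier (G i))" and eq: "\<And>i j. (i, j) \<in> r \<Longrightarrow> \<pi> i j (g j) = g i"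
      using g(1) by (auto simp: inverse_limit_def)
    have "g i \<in> B i" if i: "i \<in> I" for i
    proof (cases "i \<in> ?F")
      case True
      then have "\<pi> i k (g k) \<in> B i" using g(2) by (simp add: V_def)
      then show ?thesis using eq k(2) True by simp
    next
      case False
      then show ?thesis using i gc top[OF i] by auto
    qed
    then have "g \<in> Pi\<^sub>E I B" using gc by (auto simp: PiE_iff)
    then show ?thesis using B(4) Q(2) g(1) by blast
  qed
  ultimately show ?thesis using that[OF k(1)] by blast
qed

theorem proposition7p3:
  fixes I :: "'i set" and r :: "('i \<times> 'i) set"
    and G :: "'i \<Rightarrow> ('g, 'm) monoid_scheme" and T :: "'i \<Rightarrow> 'g topology"
    and \<pi> :: "'i \<Rightarrow> 'i \<Rightarrow> 'g \<Rightarrow> 'g"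
  assumes "surjective_inverse_system I r G T \<pi>"
    and "\<And>i. i \<in> I \<Longrightarrow> CAP TYPE('g \<Rightarrow> real) (G i) (T i)"
  shows "CAP TYPE('x) (inverse_limit I r G \<pi>) (inverse_limit_topology I r G T \<pi>)"
proof -
  interpret surjective_inverse_system I r G T \<pi> by fact
  let ?L = "inverse_limit I r G \<pi>" and ?T = "inverse_limit_topology I r G T \<pi>"
  show ?thesis
  proof (rule CAP_if_approximated_by_CAP_groups[OF topological_group_inverse_limit])
    fix U assume U: "openin ?T U" "\<one>\<^bsub>?L\<^esub> \<in> U"
    obtain k V where k: "k \<in> I" and V: "openin (T k) V" "\<one>\<^bsub>G k\<^esub> \<in> V"
      "\<And>g. g \<in> carrier ?L \<Longrightarrow> g k \<in> V \<Longrightarrow> g \<in> U"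
      using inverse_limit_neighbourhood_of_one[OF U] by metis
    have "(\<lambda>g. g k) \<in> hom ?L (G k)"
      using k by (auto simp: hom_def inverse_limit_def)
    moreover have "continuous_map ?T (T k) (\<lambda>g. g k)"
      unfolding inverse_limit_topology_def
      using k by (intro continuous_map_from_subtopology continuous_map_product_projection)
    moreover have "\<forall>g\<in>carrier ?L. g k \<in> V \<longrightarrow> g \<in> U" using V(3) by simp
    ultimately show "\<exists>(H :: ('g, 'm) monoid_scheme) S p V. topological_group H S \<and>
        CAP TYPE('g \<Rightarrow> real) H S \<and> p \<in> hom ?L H \<and> continuous_map ?T S p \<and>
        p ` carrier ?L = carrier H \<and> openin S V \<and> \<one>\<^bsub>H\<^esub> \<in> V \<and> (\<forall>g\<in>carrier ?L. p g \<in> V \<longrightarrow> g \<in> U)"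
      using groups[OF k] assms(2)[OF k] projection_surj[OF k] V(1,2)
      by (intro exI[of _ "G k"] exI[of _ "T k"] exI[of _ "\<lambda>g. g k"] exI[of _ V] conjI)
  qed
qed

end
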